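(* Uniformly in $w$ (that is, with absolute implied constants, for integers $1\le w<n$), $$nw\ln(n/w)-O(nw)\;\le\; s_w(n)\;\le\;\frac{19}{6\ln 3}\,(w+1)\,n\ln(n/w)+O(nw).$$
   Context: A graph $G$ is universal for a class of graphs $\mathcal C$ if, up to isomorphism, $G$ contains every graph in $\mathcal C$ as a (not necessarily induced) subgraph. For integers $n,w$, $s_w(n)$ denotes the minimum number of edges in an $n$-vertex graph that is universal for the class of all $n$-vertex graphs with treewidth $w$. The treewidth of a graph is the minimum, over all its tree-decompositions, of the size of the largest bag minus one. *)

theory Defs
  imports Complex_Main
begin

record 'a graph =
  verts :: "'a set"
  edges :: "'a set set"

definition finite_simple_graph :: "'a graph \<Rightarrow> bool" where
  "finite_simple_graph G \<longleftrightarrow>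
     finite (verts G) \<and> edges G \<subseteq> {e. e \<subseteq> verts G \<and> card e = 2}"

definition subgraph :: "'a graph \<Rightarrow> 'a graph \<Rightarrow> bool" where
  "subgraph H G \<longleftrightarrow> finite_simple_graph H \<and> finite_simple_graph G \<and>
     verts H \<subseteq> verts G \<and> edges H \<subseteq> edges G"

definition isomorphic :: "'a graph \<Rightarrow> 'b graph \<Rightarrow> bool" where
  "isomorphic G H \<longleftrightarrow>
     (\<exists>f. bij_betw f (verts G) (verts H) \<and> edges H = (\<lambda>e. f ` e) ` edges G)"

definition universal_for :: "'a graph \<Rightarrow> 'b graph set \<Rightarrow> bool" where
  "universal_for G \<C> \<longleftrightarrow> (\<forall>H\<in>\<C>. \<exists>H'. subgraph H' G \<and> isomorphic H H')"

definition induced :: "'a graph \<Rightarrow> 'a set \<Rightarrow> 'a graph" where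
  "induced G S = \<lparr>verts = verts G \<inter> S, edges = {e \<in> edges G. e \<subseteq> S}\<rparr>"

definition connected_graph :: "'a graph \<Rightarrow> bool" where
  "connected_graph G \<longleftrightarrow> verts G \<noteq> {} \<and>
     (\<forall>u\<in>verts G. \<forall>v\<in>verts G. (u, v) \<in> {(x, y). {x, y} \<in> edges G}\<^sup>*)"

text \<open>A cycle is given by its vertices in cyclic order, without repeating the first one.\<close>

definition is_cycle :: "'a graph \<Rightarrow> 'a list \<Rightarrow> bool" where
  "is_cycle G c \<longleftrightarrow> 3 \<le> length c \<and> distinct c \<and>
     (\<forall>i<length c. {c ! i, c ! (Suc i mod length c)} \<in> edges G)"

definition is_tree :: "'a graph \<Rightarrow> bool" where
  "is_tree T \<longleftrightarrow> finite_simple_graph T \<and> connected_graph T \<and> (\<nexists>c. is_cycle T c)"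

definition tree_decomposition :: "'a graph \<Rightarrow> 't graph \<Rightarrow> ('t \<Rightarrow> 'a set) \<Rightarrow> bool" where
  "tree_decomposition G T B \<longleftrightarrow> is_tree T \<and>
     (\<forall>t\<in>verts T. B t \<subseteq> verts G) \<and>
     (\<forall>v\<in>verts G. \<exists>t\<in>verts T. v \<in> B t) \<and>
     (\<forall>e\<in>edges G. \<exists>t\<in>verts T. e \<subseteq> B t) \<and>
     (\<forall>v\<in>verts G. connected_graph (induced T {t. v \<in> B t}))"

definition decomposition_width :: "'t graph \<Rightarrow> ('t \<Rightarrow> 'a set) \<Rightarrow> nat" where
  "decomposition_width T B = Max ((\<lambda>t. card (B t)) ` verts T) - 1"

text \<open>
  The nodes of a decomposition tree are taken in \<^typ>\<open>nat\<close>, which loses nothing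
  since the trees are finite. Because of truncated subtraction the graph
  without vertices gets treewidth 0 instead of -1.
\<close>

definition treewidth :: "'a graph \<Rightarrow> nat" where
  "treewidth G = (LEAST k. \<exists>(T :: nat graph) B.
     tree_decomposition G T B \<and> decomposition_width T B = k)"

text \<open>
  Vertices are natural numbers, so that \<open>treewidth_graphs w n\<close> contains an
  isomorphic copy of every \<open>n\<close>-vertex graph of treewidth \<open>w\<close>.
\<close>

definition treewidth_graphs :: "nat \<Rightarrow> nat \<Rightarrow> nat graph set" where
  "treewidth_graphs w n =
     {G. finite_simple_graph G \<and> card (verts G) = n \<and> treewidth G = w}"

definition s_tw :: "nat \<Rightarrow> nat \<Rightarrow> nat" where
  "s_tw w n = (LEAST m. \<exists>G :: nat graph. finite_simple_graph G \<and> card (verts G) = n \<and>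
     universal_for G (treewidth_graphs w n) \<and> card (edges G) = m)"

text \<open>The two minima above range over nonempty sets, so they are attained.\<close>

lemma treewidth_attained:
  fixes G :: "'a graph"
  assumes "finite_simple_graph G"
  shows "\<exists>(T :: nat graph) B. tree_decomposition G T B \<and> decomposition_width T B = treewidth G"
proof -
  define T :: "nat graph" where "T = \<lparr>verts = {0}, edges = {}\<rparr>"
  have "\<not> is_cycle T c" for c
  proof
    assume c: "is_cycle T c"
    then have "0 < length c" by (auto simp: is_cycle_def)
    with c show False by (auto simp: is_cycle_def T_def)
  qed
  then have "is_tree T"
    by (auto simp: is_tree_def finite_simple_graph_def connected_graph_def T_def)
  then have "tree_decomposition G T (\<lambda>_. verts G)"
    using assms
    by (auto simp: tree_decomposition_def finite_simple_graph_def connected_graph_def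
        induced_def T_def)
  then have "\<exists>k (T :: nat graph) B. tree_decomposition G T B \<and> decomposition_width T B = k"
    by blast
  then show ?thesis unfolding treewidth_def by (rule LeastI_ex)
qed

lemma s_tw_attained:
  "\<exists>G :: nat graph. finite_simple_graph G \<and> card (verts G) = n \<and>
     universal_for G (treewidth_graphs w n) \<and> card (edges G) = s_tw w n"
proof -
  define K :: "nat graph" where
    "K = \<lparr>verts = {..<n}, edges = {e. e \<subseteq> {..<n} \<and> card e = 2}\<rparr>"
  have K: "finite_simple_graph K" "card (verts K) = n"
    by (auto simp: K_def finite_simple_graph_def)
  have "universal_for K (treewidth_graphs w n)"
    unfolding universal_for_def
  proof
    fix H assume "H \<in> treewidth_graphs w n"
    then have H: "finite (verts H)" "edges H \<subseteq> {e. e \<subseteq> verts H \<and> card e = 2}"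
      "card (verts H) = n"
      by (auto simp: treewidth_graphs_def finite_simple_graph_def)
    then obtain f where f: "bij_betw f (verts H) {..<n}"
      using ex_bij_betw_finite_nat[of "verts H"] by (auto simp: atLeast0LessThan)
    define H' where "H' = \<lparr>verts = {..<n}, edges = (\<lambda>e. f ` e) ` edges H\<rparr>"
    have *: "f ` e \<subseteq> {..<n} \<and> card (f ` e) = 2" if "e \<in> edges H" for e
    proof -
      have e: "e \<subseteq> verts H" "card e = 2" using that H by auto
      then have "inj_on f e" using f by (meson bij_betw_def inj_on_subset)
      with e f show ?thesis by (auto simp: bij_betw_def card_image)
    qed
    then have "subgraph H' K"
      using K by (auto simp: subgraph_def H'_def K_def finite_simple_graph_def)
    moreover have "isomorphic H H'"
      using f by (auto simp: isomorphic_def H'_def)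
    ultimately show "\<exists>H'. subgraph H' K \<and> isomorphic H H'" by blast
  qed
  with K have "\<exists>m. \<exists>G :: nat graph. finite_simple_graph G \<and> card (verts G) = n \<and>
     universal_for G (treewidth_graphs w n) \<and> card (edges G) = m" by blast
  then show ?thesis unfolding s_tw_def by (rule LeastI_ex)
qed

end

theory Submission
  imports Defs
begin

text \<open>
  Lower bound: take \<open>k\<close> disjoint blocks of size \<open>n div k\<close>, in each of which \<open>w\<close> hubs are joined to all
  other vertices. If fewer than \<open>k * w\<close> vertices of a universal graph are deleted, some block of the
  embedded copy retains a hub, which still has degree at least \<open>n div k - w\<close>. So deleting vertices of
  maximal degree one by one finds about \<open>w * (n / 1 + n / 2 + \<dots> + n / (n div w))\<close> edges.

  Upper bound: the vertices of the universal graph form a sequence of slots that is cut recursively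
  into nodes. Each node starts with \<open>w + 1\<close> separator slots, which are adjacent to everything within a
  reach proportional to the length of the node, and its last pieces are short runs of leaves. A graph
  of treewidth \<open>w\<close> is placed from left to right. What remains to be placed is kept in a chain of sets
  without edges leaving them. When a node starts, a bag is placed that splits the first set of the
  chain that is too large into parts, so that the chain has a set just long enough for the node. If
  the parts are consumed in decreasing order of size, then at offset \<open>x\<close> inside the node the current
  part ends before \<open>2 * x\<close> or before the end of the node. Hence a child at offset \<open>o\<close> of length \<open>k\<close> in a
  node of length \<open>1\<close> needs a reach of only about \<open>max (1 - o) (o + 2 * k)\<close>. With four children of
  lengths \<open>p, q, q, p\<close> the total reach is \<open>7 * p + 9 * q\<close>, and \<open>p / q \<approx> 1.77\<close> brings the constant below
  \<open>19 / (6 * ln 3)\<close>.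
\<close>

section \<open>Rooted tree decompositions\<close>

lemma rtrancl_distinct_path:
  assumes "(x, y) \<in> R\<^sup>*"
  obtains p where "p \<noteq> []" "hd p = x" "last p = y" "distinct p"
    "\<And>i. Suc i < length p \<Longrightarrow> (p ! i, p ! Suc i) \<in> R"
proof -
  from assms have "\<exists>p. p \<noteq> [] \<and> hd p = x \<and> last p = y \<and> distinct p \<and>
      (\<forall>i. Suc i < length p \<longrightarrow> (p ! i, p ! Suc i) \<in> R)"
  proof (induction rule: rtrancl_induct)
    case base
    show ?case by (rule exI[of _ "[x]"]) simp
  next
    case (step y z)
    then obtain p where p: "p \<noteq> []" "hd p = x" "last p = y" "distinct p"
      "\<And>i. Suc i < length p \<Longrightarrow> (p ! i, p ! Suc i) \<in> R" by blast
    show ?case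
    proof (cases "z \<in> set p")
      \<comment> \<open>A vertex that already lies on the path closes a loop, which is removed by
        cutting the path off behind it.\<close>
      case True
      then obtain k where k: "k < length p" "p ! k = z" by (auto simp: in_set_conv_nth)
      show ?thesis
      proof (intro exI conjI)
        show "take (Suc k) p \<noteq> []" "distinct (take (Suc k) p)" "hd (take (Suc k) p) = x"
          using p by (auto simp: hd_take)
        show "last (take (Suc k) p) = z" using k by (simp add: take_Suc_conv_app_nth)
        show "\<forall>i. Suc i < length (take (Suc k) p) \<longrightarrow>
            (take (Suc k) p ! i, take (Suc k) p ! Suc i) \<in> R"
          using p(5) by simp
      qed
    next
      case False
      have "(p @ [z]) ! i = p ! i" if "i < length p" for i using that by (simp add: nth_append)
      moreover have "(p ! i, z) \<in> R" if "Suc i = length p" for i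
        using p(1,3) step that by (metis diff_Suc_1 last_conv_nth)
      ultimately have "((p @ [z]) ! i, (p @ [z]) ! Suc i) \<in> R" if "Suc i < length (p @ [z])" for i
        using p(5)[of i] that by (cases "Suc i = length p") (auto simp: nth_append)
      with p False show ?thesis by (intro exI[of _ "p @ [z]"]) auto
    qed
  qed
  with that show ?thesis by blast
qed

lemma rtrancl_leaves_set:
  assumes "(x, y) \<in> R\<^sup>*" "x \<in> S" "y \<notin> S"
  shows "\<exists>u v. (u, v) \<in> R \<and> u \<in> S \<and> v \<notin> S"
  using assms by (induction rule: rtrancl_induct) blast+

text \<open>A longest admissible list contains all vertices: otherwise a walk from its head to a
  missing vertex leaves the list along an edge whose far end could be appended.\<close>

lemma connected_enumeration:
  assumes "finite_simple_graph T" "connected_graph T"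
  obtains ts where "distinct ts" "set ts = verts T" "ts \<noteq> []"
    "\<And>i. 0 < i \<Longrightarrow> i < length ts \<Longrightarrow> \<exists>j<i. {ts ! j, ts ! i} \<in> edges T"
proof -
  define Q where "Q ts \<longleftrightarrow> distinct ts \<and> set ts \<subseteq> verts T \<and> ts \<noteq> [] \<and>
    (\<forall>i. 0 < i \<longrightarrow> i < length ts \<longrightarrow> (\<exists>j<i. {ts ! j, ts ! i} \<in> edges T))" for ts
  have fin: "finite (verts T)" using assms(1) by (simp add: finite_simple_graph_def)
  obtain r where "r \<in> verts T" using assms(2) by (auto simp: connected_graph_def)
  then have "Q [r]" by (simp add: Q_def)
  moreover have "\<forall>ts. Q ts \<longrightarrow> length ts \<le> card (verts T)"
    by (metis Q_def card_mono distinct_card fin)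
  ultimately obtain ts where ts: "Q ts" and max: "\<And>us. Q us \<Longrightarrow> length us \<le> length ts"
    using ex_has_greatest_nat[of Q "[r]" length "Suc (card (verts T))"]
    by (metis less_Suc_eq_le)
  have "verts T \<subseteq> set ts"
  proof
    fix y assume y: "y \<in> verts T"
    show "y \<in> set ts"
    proof (rule ccontr)
      assume "y \<notin> set ts"
      moreover have "hd ts \<in> set ts" "hd ts \<in> verts T" using ts by (auto simp: Q_def)
      moreover have "(hd ts, y) \<in> {(x, y). {x, y} \<in> edges T}\<^sup>*"
        using assms(2) y \<open>hd ts \<in> verts T\<close> by (auto simp: connected_graph_def)
      ultimately obtain u v where uv: "{u, v} \<in> edges T" "u \<in> set ts" "v \<notin> set ts"
        using rtrancl_leaves_set[of "hd ts" y "{(x, y). {x, y} \<in> edges T}" "set ts"] by blast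
      from uv(1) have "v \<in> verts T" using assms(1) by (auto simp: finite_simple_graph_def)
      obtain j where j: "j < length ts" "ts ! j = u" using uv(2) by (auto simp: in_set_conv_nth)
      have "\<exists>j<i. {(ts @ [v]) ! j, (ts @ [v]) ! i} \<in> edges T"
        if i: "0 < i" "i < length (ts @ [v])" for i
      proof (cases "i = length ts")
        case True
        with j uv(1) show ?thesis by (intro exI[of _ j]) (auto simp: nth_append)
      next
        case False
        with i have "i < length ts" by simp
        with ts i obtain k where "k < i" "{ts ! k, ts ! i} \<in> edges T" by (auto simp: Q_def)
        with \<open>i < length ts\<close> show ?thesis by (intro exI[of _ k]) (auto simp: nth_append)
      qed
      with ts uv(3) \<open>v \<in> verts T\<close> have "Q (ts @ [v])" by (auto simp: Q_def)
      with max show False by fastforce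
    qed
  qed
  with ts show ?thesis by (intro that[of ts]) (auto simp: Q_def)
qed

text \<open>Parents are numbered before their children, with root \<open>0\<close>. The axiom
  \<open>bag_par\<close> encodes that the nodes whose bags contain \<open>v\<close> are connected:
  only the first of them may have a parent without \<open>v\<close> in its bag.\<close>

locale rooted_decomposition =
  fixes V :: "'a set" and E :: "'a set set" and m :: nat and par :: "nat \<Rightarrow> nat"
    and B :: "nat \<Rightarrow> 'a set"
  assumes par_less: "0 < i \<Longrightarrow> i < m \<Longrightarrow> par i < i"
    and vertex_in_bag: "v \<in> V \<Longrightarrow> \<exists>i<m. v \<in> B i"
    and edge_in_bag: "e \<in> E \<Longrightarrow> \<exists>i<m. e \<subseteq> B i"
    and bag_par: "i < m \<Longrightarrow> j < i \<Longrightarrow> v \<in> B i \<Longrightarrow> v \<in> B j \<Longrightarrow> v \<in> B (par i)"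
begin

definition up :: "(nat \<times> nat) set" where
  "up = {(i, par i) |i. 0 < i \<and> i < m}"

definition top_node :: "'a \<Rightarrow> nat" where
  "top_node v = (LEAST i. i < m \<and> v \<in> B i)"

lemma single_valued_up: "single_valued up"
  by (auto simp: up_def single_valued_def)

lemma up_le: "(i, j) \<in> up\<^sup>* \<Longrightarrow> j \<le> i"
proof (induction rule: rtrancl_induct)
  case (step j k)
  then show ?case using par_less[of j] by (auto simp: up_def)
qed simp

lemma root_reachable: "i < m \<Longrightarrow> (i, 0) \<in> up\<^sup>*"
proof (induction i rule: less_induct)
  case (less i)
  show ?case
  proof (cases "i = 0")
    case False
    with less.prems have "(i, par i) \<in> up" by (auto simp: up_def)
    moreover have "par i < i" using False less.prems by (simp add: par_less)
    ultimately show ?thesis using less by (meson converse_rtrancl_into_rtrancl order.strict_trans)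
  qed simp
qed

text \<open>Every node that is left on the way up from \<open>k\<close> to \<open>i\<close> has an
  index above \<open>i\<close>, hence above \<open>j\<close>, so \<open>bag_par\<close> hands
  \<open>v\<close> on to its parent.\<close>

lemma bag_up:
  assumes "(k, i) \<in> up\<^sup>*" "k < m" "v \<in> B k" "v \<in> B j" "j \<le> i"
  shows "v \<in> B i"
  using assms
proof (induction rule: converse_rtrancl_induct)
  case (step k l)
  then have kl: "0 < k" "l = par k" by (auto simp: up_def)
  with step.prems have "l < k" by (simp add: par_less)
  moreover have "j < k" using up_le[OF step.hyps(2)] \<open>l < k\<close> step.prems by simp
  ultimately show ?case using step kl bag_par by auto
qed simp

lemma top_node:
  assumes "i < m" "v \<in> B i"
  shows "top_node v < m" "v \<in> B (top_node v)" "top_node v \<le> i" "(i, top_node v) \<in> up\<^sup>*"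
proof -
  have "top_node v < m \<and> v \<in> B (top_node v)"
    unfolding top_node_def using assms by (rule LeastI[OF conjI])
  then show t: "top_node v < m" "v \<in> B (top_node v)" by auto
  show "top_node v \<le> i" unfolding top_node_def using assms by (intro Least_le) auto
  have "k < m \<Longrightarrow> v \<in> B k \<Longrightarrow> (k, top_node v) \<in> up\<^sup>*" for k
  proof (induction k rule: less_induct)
    case (less k)
    have "top_node v \<le> k" unfolding top_node_def using less.prems by (intro Least_le) auto
    show ?case
    proof (cases "k = top_node v")
      case False
      with \<open>top_node v \<le> k\<close> have "top_node v < k" by simp
      then have "v \<in> B (par k)" "(k, par k) \<in> up" "par k < k"
        using less.prems t bag_par par_less by (auto simp: up_def)
      then show ?thesis using less by (meson converse_rtrancl_into_rtrancl order.strict_trans)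
    qed simp
  qed
  with assms show "(i, top_node v) \<in> up\<^sup>*" by blast
qed

text \<open>Helly property of subtrees. The latest top node in the clique works, say that of
  \<open>v\<close>: any other \<open>u\<close> shares a bag with \<open>v\<close> at or below it,
  and its own top node comes no later, so \<open>bag_up\<close> carries \<open>u\<close>
  there.\<close>

lemma clique_in_bag:
  assumes "finite K" "K \<noteq> {}" "K \<subseteq> V"
    and clique: "\<And>u v. u \<in> K \<Longrightarrow> v \<in> K \<Longrightarrow> u \<noteq> v \<Longrightarrow> {u, v} \<in> E"
  shows "\<exists>i<m. K \<subseteq> B i"
proof -
  obtain v where v: "v \<in> K" and max: "\<And>u. u \<in> K \<Longrightarrow> top_node u \<le> top_node v"
  proof -
    have "Max (top_node ` K) \<in> top_node ` K" using assms(1,2) by simp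
    then obtain v where "v \<in> K" "top_node v = Max (top_node ` K)" by auto
    moreover have "top_node u \<le> Max (top_node ` K)" if "u \<in> K" for u using that assms(1) by simp
    ultimately show thesis by (intro that) auto
  qed
  have t: "top_node v < m" "v \<in> B (top_node v)"
    using v assms(3) vertex_in_bag top_node by blast+
  have "u \<in> B (top_node v)" if u: "u \<in> K" for u
  proof (cases "u = v")
    case False
    then obtain j where j: "j < m" "{u, v} \<subseteq> B j" using clique u v edge_in_bag by blast
    then show ?thesis
      using bag_up[of j "top_node v" u "top_node u"] top_node[of j] max[OF u] by auto
  qed (use t in simp)
  with t show ?thesis by blast
qed

text \<open>
  A deepest node \<open>i\<close> below which at least \<open>\<alpha>\<close> vertices of \<open>A\<close> live separates \<open>A\<close> into the parts
  below its children, each of which is smaller than \<open>\<alpha>\<close>, and a rest.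
\<close>

lemma separator:
  assumes "finite A" "A \<subseteq> V" "1 \<le> \<alpha>" "\<alpha> \<le> card A"
  obtains i cs where "i < m"
    "\<And>c. c \<in> set cs \<Longrightarrow> c \<subseteq> A - B i \<and> card c < \<alpha> \<and> card c \<le> card (hd cs)"
    "\<And>c u v. c \<in> set cs \<Longrightarrow> u \<in> c \<Longrightarrow> v \<in> A - c - B i \<Longrightarrow> {u, v} \<notin> E"
    "\<alpha> \<le> card (A \<inter> B i) + card (\<Union> (set cs))"
proof -
  define sub where "sub i = {v \<in> A. (top_node v, i) \<in> up\<^sup>*}" for i
  define I where "I = {i. i < m \<and> \<alpha> \<le> card (sub i)}"
  have top: "top_node v < m" "v \<in> B (top_node v)" if "v \<in> A" for v
    using that assms(2) vertex_in_bag top_node by blast+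
  have "sub 0 = A" using root_reachable top by (auto simp: sub_def)
  moreover have "A \<noteq> {}" using assms(3,4) by auto
  then have "0 < m" using top by fastforce
  ultimately have "0 \<in> I" using assms by (simp add: I_def)
  moreover have "finite I" by (simp add: I_def)
  \<comment> \<open>The largest index in \<open>I\<close> serves as a deepest node: its children
    have larger indices and so lie outside \<open>I\<close>.\<close>
  ultimately obtain i where i: "i \<in> I" and max: "\<And>k. k \<in> I \<Longrightarrow> k \<le> i"
    by (metis Max_ge Max_in empty_iff)
  have im: "i < m" using i by (simp add: I_def)
  define \<C> where "\<C> = sub ` {k. 0 < k \<and> k < m \<and> par k = i}"
  obtain cs0 where "set cs0 = \<C>" using finite_list[of \<C>] by (auto simp: \<C>_def)
  define cs where "cs = rev (sort_key card cs0)"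
  have cs: "set cs = \<C>" using \<open>set cs0 = \<C>\<close> by (simp add: cs_def)
  have hd: "card c \<le> card (hd cs)" if "c \<in> set cs" for c
  proof -
    define ds where "ds = sort_key card cs0"
    have "sorted (map card ds)" by (simp add: ds_def)
    moreover have "cs = rev ds" by (simp add: cs_def ds_def)
    moreover have "ds \<noteq> []" using that calculation by auto
    ultimately show ?thesis using that
      by (auto simp: hd_rev in_set_conv_nth last_conv_nth sorted_iff_nth_mono)
  qed
  have child: "c \<subseteq> A - B i \<and> card c < \<alpha> \<and> (\<forall>u\<in>c. \<forall>v\<in>A - c - B i. {u, v} \<notin> E)" if c: "c \<in> set cs" for c
  proof -
    obtain k where k: "c = sub k" "0 < k" "k < m" "par k = i" using c cs by (auto simp: \<C>_def)
    then have "i < k" and ki: "(k, i) \<in> up" using par_less by (auto simp: up_def)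
    then have "k \<notin> I" using max by fastforce
    then have "card c < \<alpha>" using k by (auto simp: I_def)
    moreover have "v \<notin> B i" if "v \<in> c" for v
    proof
      assume "v \<in> B i"
      then have "top_node v \<le> i" using im top_node by blast
      moreover have "k \<le> top_node v" using that k up_le by (auto simp: sub_def)
      ultimately show False using \<open>i < k\<close> by simp
    qed
    \<comment> \<open>A bag containing such an edge lies at or below \<open>k\<close>. The top node
      of \<open>v\<close> is above this bag but not below \<open>k\<close>, so it is a proper
      ancestor of \<open>k\<close>, and \<open>v\<close> would lie in the bag of the parent
      \<open>i\<close>.\<close>
    moreover have False if uv: "u \<in> c" "v \<in> A - c - B i" "{u, v} \<in> E" for u v
    proof -
      obtain j where j: "j < m" "u \<in> B j" "v \<in> B j" using edge_in_bag[OF uv(3)] by auto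
      have "(top_node u, k) \<in> up\<^sup>*" using uv k by (simp add: sub_def)
      then have jk: "(j, k) \<in> up\<^sup>*" using top_node(4)[of j u] j by (meson rtrancl_trans)
      have jv: "(j, top_node v) \<in> up\<^sup>*" using top_node(4) j by blast
      have nk: "(top_node v, k) \<notin> up\<^sup>*" using uv k by (simp add: sub_def)
      then have "(k, top_node v) \<in> up\<^sup>*"
        using single_valued_confluent[OF single_valued_up jk jv] by blast
      then obtain l where "(k, l) \<in> up" "(l, top_node v) \<in> up\<^sup>*"
        using nk by (metis converse_rtranclE rtrancl.rtrancl_refl)
      then have "top_node v \<le> i" using up_le k by (auto simp: up_def)
      moreover have "(j, i) \<in> up\<^sup>*" using jk ki by simp
      ultimately have "v \<in> B i" using bag_up[of j i v "top_node v"] j top uv by auto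
      with uv show False by simp
    qed
    ultimately show ?thesis using k by (auto simp: sub_def)
  qed
  have "sub i \<subseteq> (A \<inter> B i) \<union> \<Union> (set cs)"
  proof
    fix v assume v: "v \<in> sub i"
    then have vA: "v \<in> A" and "(top_node v, i) \<in> up\<^sup>*" by (auto simp: sub_def)
    from this(2) show "v \<in> (A \<inter> B i) \<union> \<Union> (set cs)"
    proof (cases rule: rtranclE)
      case base
      then show ?thesis using vA top by auto
    next
      case (step k)
      then show ?thesis using vA unfolding cs \<C>_def by (force simp: sub_def up_def)
    qed
  qed
  moreover have "finite (\<Union> (set cs))"
    using child assms(1) by (meson Sup_least finite_Diff finite_subset)
  ultimately have "card (sub i) \<le> card (A \<inter> B i) + card (\<Union> (set cs))"
    by (meson assms(1) card_Un_le card_mono finite_Int finite_Un order.trans)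
  then have "\<alpha> \<le> card (A \<inter> B i) + card (\<Union> (set cs))" using i by (simp add: I_def)
  with im child hd show ?thesis by (intro that[of i cs]) blast+
qed

end

text \<open>
  Listing the nodes of a tree so that each one is adjacent to an earlier one determines a parent
  function, and acyclicity leaves no other edges.
\<close>

lemma tree_edges_parent:
  assumes T: "is_tree T" and ts: "distinct ts" "set ts = verts T"
    and par: "\<And>i. 0 < i \<Longrightarrow> i < length ts \<Longrightarrow> par i < i \<and> {ts ! par i, ts ! i} \<in> edges T"
    and ab: "a < b" "b < length ts" "{ts ! a, ts ! b} \<in> edges T"
  shows "a = par b"
proof (rule ccontr)
  assume ne: "a \<noteq> par b"
  \<comment> \<open>All nodes before \<open>b\<close> are linked to node \<open>0\<close> without
    using \<open>b\<close>. So there is a path from \<open>a\<close> to \<open>par b\<close> that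
    avoids \<open>b\<close>, and \<open>b\<close> closes it to a cycle.\<close>
  define R where "R = {(i, j). i < b \<and> j < b \<and> {ts ! i, ts ! j} \<in> edges T}"
  have "sym R" by (auto simp: R_def sym_def insert_commute)
  have R0: "(i, 0) \<in> R\<^sup>*" if "i < b" for i
    using that
  proof (induction i rule: less_induct)
    case (less i)
    show ?case
    proof (cases "i = 0")
      case False
      then have "par i < i" "(i, par i) \<in> R"
        using par[of i] less.prems ab by (auto simp: R_def insert_commute)
      with less show ?thesis by (meson converse_rtrancl_into_rtrancl order.strict_trans)
    qed simp
  qed
  have pb: "par b < b" "{ts ! par b, ts ! b} \<in> edges T" using par[of b] ab by auto
  have "(0, par b) \<in> R\<^sup>*" using R0[OF pb(1)] \<open>sym R\<close> by (meson sym_rtrancl symE)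
  with R0[OF ab(1)] have "(a, par b) \<in> R\<^sup>*" by simp
  then obtain p where p: "p \<noteq> []" "hd p = a" "last p = par b" "distinct p"
    "\<And>i. Suc i < length p \<Longrightarrow> (p ! i, p ! Suc i) \<in> R"
    using rtrancl_distinct_path[OF \<open>(a, par b) \<in> R\<^sup>*\<close>] by blast
  have len: "2 \<le> length p" using p(1-3) ne by (cases p rule: remdups_adj.cases) auto
  have less: "x < b" if x: "x \<in> set p" for x
  proof -
    obtain i where i: "i < length p" "x = p ! i" using x by (auto simp: in_set_conv_nth)
    then show ?thesis
      using p(5)[of i] p(5)[of "i - 1"] len by (cases i) (auto simp: R_def)
  qed
  define c where "c = map ((!) ts) (p @ [b])"
  have "is_cycle T c"
    unfolding is_cycle_def
  proof (intro conjI allI impI)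
    show "3 \<le> length c" using len by (simp add: c_def)
    have "inj_on ((!) ts) (set (p @ [b]))"
      using less ab(2) by (intro inj_on_nth[OF ts(1)]) (auto dest: less_trans)
    then show "distinct c" unfolding c_def distinct_map using p(4) less by auto
    fix i assume i: "i < length c"
    consider "Suc i < length p" | "Suc i = length p" | "i = length p" using i by (force simp: c_def)
    then show "{c ! i, c ! (Suc i mod length c)} \<in> edges T"
    proof cases
      case 1
      then show ?thesis using p(5)[of i] by (auto simp: c_def nth_append R_def)
    next
      case 2
      then have "p ! i = par b" using p(1,3) by (metis diff_Suc_1 last_conv_nth)
      with 2 show ?thesis using pb by (auto simp: c_def nth_append)
    next
      case 3
      then show ?thesis using ab p(1,2) by (auto simp: c_def nth_append hd_conv_nth insert_commute)
    qed
  qed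
  with T show False by (auto simp: is_tree_def)
qed

text \<open>For \<open>bag_par\<close>, a walk from node \<open>i\<close> to an earlier node
  \<open>j\<close> through bags containing \<open>v\<close> leaves the descendants of
  \<open>i\<close>, because their indices are at least \<open>i\<close>. By
  \<open>tree_edges_parent\<close> the only edge that leaves them joins \<open>i\<close> to its
  parent, so the bag of the parent contains \<open>v\<close>.\<close>

lemma tree_decomposition_rooted:
  assumes "tree_decomposition G T B"
  obtains ts par where "rooted_decomposition (verts G) (edges G) (length ts) par (\<lambda>i. B (ts ! i))"
    "set ts = verts T"
proof -
  have T: "is_tree T" and bag: "\<And>v. v \<in> verts G \<Longrightarrow> \<exists>t\<in>verts T. v \<in> B t"
    "\<And>e. e \<in> edges G \<Longrightarrow> \<exists>t\<in>verts T. e \<subseteq> B t"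
    and sub: "\<And>t. t \<in> verts T \<Longrightarrow> B t \<subseteq> verts G"
    and conn: "\<And>v. v \<in> verts G \<Longrightarrow> connected_graph (induced T {t. v \<in> B t})"
    using assms by (auto simp: tree_decomposition_def)
  have fT: "finite_simple_graph T" "connected_graph T" using T by (auto simp: is_tree_def)
  obtain ts where ts: "distinct ts" "set ts = verts T" "ts \<noteq> []"
    and ex: "\<And>i. 0 < i \<Longrightarrow> i < length ts \<Longrightarrow> \<exists>j<i. {ts ! j, ts ! i} \<in> edges T"
    using connected_enumeration[OF fT] by blast
  from ex obtain par where
    par: "\<And>i. 0 < i \<Longrightarrow> i < length ts \<Longrightarrow> par i < i \<and> {ts ! par i, ts ! i} \<in> edges T"
    by metis
  define below where "below i = {k. k < length ts \<and> (k, i) \<in> {(l, par l) |l. 0 < l \<and> l < length ts}\<^sup>*}" for i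
  have ge: "i \<le> k" if "k \<in> below i" for i k
  proof -
    from that have "(k, i) \<in> {(l, par l) |l. 0 < l \<and> l < length ts}\<^sup>*" by (simp add: below_def)
    then show ?thesis
    proof (induction rule: rtrancl_induct)
      case (step j l)
      then show ?case using par[of j] by auto
    qed simp
  qed
  have bp: "v \<in> B (ts ! par i)"
    if ij: "i < length ts" "j < i" "v \<in> B (ts ! i)" "v \<in> B (ts ! j)" for i j v
  proof (rule ccontr)
    assume nv: "v \<notin> B (ts ! par i)"
    define R where "R = {(x, y). {x, y} \<in> edges (induced T {t. v \<in> B t})}"
    have mem: "ts ! i \<in> verts T" "ts ! j \<in> verts T" using ij ts(2) nth_mem less_trans by blast+
    then have "v \<in> verts G" using sub ij by blast
    then have "(ts ! i, ts ! j) \<in> R\<^sup>*"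
      using conn[of v] ij mem by (auto simp: connected_graph_def R_def induced_def)
    moreover have "ts ! j \<notin> (!) ts ` below i"
    proof
      assume "ts ! j \<in> (!) ts ` below i"
      then obtain k where "k \<in> below i" "ts ! j = ts ! k" by blast
      moreover from this have "j = k"
        using ij ts(1) by (simp add: below_def nth_eq_iff_index_eq)
      ultimately show False using ge ij by fastforce
    qed
    moreover have "ts ! i \<in> (!) ts ` below i" using ij by (auto simp: below_def)
    ultimately obtain x y where xy: "(x, y) \<in> R" "x \<in> (!) ts ` below i" "y \<notin> (!) ts ` below i"
      using rtrancl_leaves_set by meson
    then obtain k where k: "k \<in> below i" "x = ts ! k" by blast
    have E: "{x, y} \<in> edges T" "v \<in> B y" using xy(1) by (auto simp: R_def induced_def)
    then have "y \<in> verts T" using fT by (auto simp: finite_simple_graph_def)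
    then obtain l where l: "l < length ts" "y = ts ! l" using ts(2) by (metis in_set_conv_nth)
    have kl: "k < length ts" using k by (simp add: below_def)
    have "k \<noteq> l" using E k l fT by (auto simp: finite_simple_graph_def)
    then consider "k < l" | "l < k" by linarith
    then show False
    proof cases
      case 1
      then have "k = par l" using tree_edges_parent[OF T ts(1,2) par] E k l by auto
      then have "l \<in> below i" using k l 1 unfolding below_def
        by (auto intro: converse_rtrancl_into_rtrancl)
      with xy l show False by blast
    next
      case 2
      then have l': "l = par k"
        using tree_edges_parent[OF T ts(1,2) par] E k l kl by (auto simp: insert_commute)
      show False
      proof (cases "k = i")
        case True
        with l' E l nv show False by simp
      next
        case False
        have "(k, i) \<in> {(l, par l) |l. 0 < l \<and> l < length ts}\<^sup>*" using k by (simp add: below_def)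
        then have "l \<in> below i" using False l l'
          by (cases rule: converse_rtranclE) (auto simp: below_def)
        with xy l show False by blast
      qed
    qed
  qed
  have "rooted_decomposition (verts G) (edges G) (length ts) par (\<lambda>i. B (ts ! i))"
    by unfold_locales (use par bp bag ts(2) in \<open>metis in_set_conv_nth\<close>)+
  with ts(2) that show ?thesis by blast
qed

section \<open>The lower bound\<close>

text \<open>By \<open>clique_in_bag\<close> a single bag contains the clique. This gives the lower
  half of the treewidth of the hub graphs, which has to be exactly \<open>w\<close>.\<close>

lemma clique_le_treewidth:
  assumes G: "finite_simple_graph G" and K: "K \<noteq> {}" "K \<subseteq> verts G"
    and clique: "\<And>u v. u \<in> K \<Longrightarrow> v \<in> K \<Longrightarrow> u \<noteq> v \<Longrightarrow> {u, v} \<in> edges G"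
  shows "card K \<le> treewidth G + 1"
proof -
  obtain T :: "nat graph" and B where T: "tree_decomposition G T B"
    and width: "decomposition_width T B = treewidth G"
    using treewidth_attained[OF G] by blast
  obtain ts par where ts: "rooted_decomposition (verts G) (edges G) (length ts) par (\<lambda>i. B (ts ! i))"
    "set ts = verts T"
    using tree_decomposition_rooted[OF T] by blast
  have finV: "finite (verts G)" using G by (simp add: finite_simple_graph_def)
  then have "finite K" using K finite_subset by blast
  then obtain i where i: "i < length ts" "K \<subseteq> B (ts ! i)"
    using rooted_decomposition.clique_in_bag[OF ts(1) _ K clique] by blast
  then have t: "ts ! i \<in> verts T" using ts(2) nth_mem by blast
  then have "finite (B (ts ! i))" using T finV finite_subset by (auto simp: tree_decomposition_def)
  then have "card K \<le> card (B (ts ! i))" using i card_mono by blast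
  also have "\<dots> \<le> Max ((\<lambda>t. card (B t)) ` verts T)"
    using t T by (intro Max_ge) (auto simp: tree_decomposition_def is_tree_def finite_simple_graph_def)
  finally show ?thesis using width by (simp add: decomposition_width_def)
qed

lemma treewidth_le:
  fixes T :: "nat graph"
  assumes T: "tree_decomposition G T B" and small: "\<And>t. t \<in> verts T \<Longrightarrow> card (B t) \<le> k + 1"
  shows "treewidth G \<le> k"
proof -
  have "treewidth G \<le> decomposition_width T B"
    unfolding treewidth_def using T by (intro Least_le) blast
  moreover have "verts T \<noteq> {}" "finite (verts T)"
    using T by (auto simp: tree_decomposition_def is_tree_def connected_graph_def finite_simple_graph_def)
  then have "Max ((\<lambda>t. card (B t)) ` verts T) \<le> k + 1" using small by simp
  ultimately show ?thesis by (simp add: decomposition_width_def)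
qed

section \<open>Path decompositions of hub graphs\<close>

definition path_graph :: "nat \<Rightarrow> nat graph" where
  "path_graph n = \<lparr>verts = {..<n}, edges = {{i, Suc i} |i. Suc i < n}\<rparr>"

lemma connected_induced_path:
  assumes S: "S \<subseteq> {..<n}" "S \<noteq> {}"
    and conv: "\<And>x y z. x \<in> S \<Longrightarrow> z \<in> S \<Longrightarrow> x \<le> y \<Longrightarrow> y \<le> z \<Longrightarrow> y \<in> S"
  shows "connected_graph (induced (path_graph n) S)"
proof -
  define R where "R = {(x, y). {x, y} \<in> edges (induced (path_graph n) S)}"
  have "sym R" by (auto simp: R_def sym_def insert_commute)
  have le: "y \<in> S \<Longrightarrow> (x, y) \<in> R\<^sup>*" if "x \<in> S" "x \<le> y" for x y
    using that(2)
  proof (induction y rule: dec_induct)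
    case (step y)
    have "y \<in> S" using step conv[of x "Suc y" y] that by simp
    then have "(y, Suc y) \<in> R" using step S by (auto simp: R_def induced_def path_graph_def)
    with step \<open>y \<in> S\<close> show ?case by auto
  qed simp
  have "(x, y) \<in> R\<^sup>*" if "x \<in> S" "y \<in> S" for x y
  proof (cases "x \<le> y")
    case False
    then have "(y, x) \<in> R\<^sup>*" using le that by simp
    then show ?thesis using \<open>sym R\<close> by (meson sym_rtrancl symE)
  qed (use le that in blast)
  moreover have "verts (induced (path_graph n) S) = S" using S by (auto simp: induced_def path_graph_def)
  ultimately show ?thesis using S by (simp add: connected_graph_def R_def)
qed

lemma is_tree_path_graph:
  assumes "0 < n"
  shows "is_tree (path_graph n)"
proof -
  have "finite_simple_graph (path_graph n)"
    by (auto simp: finite_simple_graph_def path_graph_def)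
  moreover have "connected_graph (path_graph n)"
  proof -
    have "induced (path_graph n) {..<n} = path_graph n" by (auto simp: induced_def path_graph_def)
    moreover have "connected_graph (induced (path_graph n) {..<n})"
      using assms by (intro connected_induced_path) auto
    ultimately show ?thesis by simp
  qed
  moreover have "\<not> is_cycle (path_graph n) c" for c
  proof
    assume "is_cycle (path_graph n) c"
    then have c: "3 \<le> length c" "distinct c"
      and e: "\<And>i. i < length c \<Longrightarrow> {c ! i, c ! (Suc i mod length c)} \<in> edges (path_graph n)"
      by (auto simp: is_cycle_def)
    have adj: "x = Suc y \<or> y = Suc x" if "{x, y} \<in> edges (path_graph n)" for x y
      using that by (auto simp: path_graph_def doubleton_eq_iff)
    \<comment> \<open>Both cyclic neighbours of the largest vertex \<open>M\<close> of the cycle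
      must be its predecessor on the path, but they are different.\<close>
    define M where "M = Max (set c)"
    have "M \<in> set c" using c(1) by (auto simp: M_def intro!: Max_in)
    then obtain k where k: "k < length c" "c ! k = M" by (auto simp: in_set_conv_nth)
    have le: "c ! i \<le> M" if "i < length c" for i using that by (auto simp: M_def)
    define a where "a = Suc k mod length c"
    define b where "b = (if k = 0 then length c - 1 else k - 1)"
    have "0 < length c" using c(1) by linarith
    then have ab: "a < length c" "b < length c" using k(1) by (auto simp: a_def b_def)
    have "Suc b mod length c = k" using c(1) k(1) by (auto simp: b_def)
    then have "{c ! b, M} \<in> edges (path_graph n)" using e[OF ab(2)] k by simp
    moreover have "{M, c ! a} \<in> edges (path_graph n)" using e[OF k(1)] k by (simp add: a_def)
    ultimately have "c ! a = c ! b" using adj[of "c ! b" M] adj[of M "c ! a"] le[OF ab(1)] le[OF ab(2)] by linarith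
    then have "a = b" using c(2) ab by (simp add: nth_eq_iff_index_eq)
    moreover have "a \<noteq> b"
      unfolding a_def b_def using c(1) k(1) by (auto simp: mod_Suc)
    ultimately show False by simp
  qed
  ultimately show ?thesis by (auto simp: is_tree_def)
qed

text \<open>A block consists of the numbers with the same quotient by \<open>m\<close>, and its hubs
  are its \<open>w\<close> smallest elements. Hence it is enough to ask that the smaller end of an
  edge is a hub. Vertices from \<open>k * m\<close> on are isolated and pad the graph to order
  \<open>n\<close>.\<close>

definition hub_graph :: "nat \<Rightarrow> nat \<Rightarrow> nat \<Rightarrow> nat \<Rightarrow> nat graph" where
  "hub_graph w m k n = \<lparr>verts = {..<n},
     edges = {{u, v} |u v. u < v \<and> v < k * m \<and> u div m = v div m \<and> u mod m < w}\<rparr>"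

lemma hub_edge:
  assumes "u < k * m" "v < k * m" "u \<noteq> v" "u div m = v div m" "u mod m < w"
  shows "{u, v} \<in> edges (hub_graph w m k n)"
proof (cases "u < v")
  case False
  then have "v < u" using assms by simp
  moreover from this have "v mod m < u mod m"
    using assms(4) by (metis div_mult_mod_eq nat_add_left_cancel_less)
  ultimately have "{v, u} \<in> edges (hub_graph w m k n)"
    unfolding hub_graph_def using assms by fastforce
  then show ?thesis by (simp add: insert_commute)
qed (use assms in \<open>auto simp: hub_graph_def\<close>)

lemma finite_simple_hub_graph: "k * m \<le> n \<Longrightarrow> finite_simple_graph (hub_graph w m k n)"
  unfolding finite_simple_graph_def hub_graph_def by (fastforce dest: less_le_trans)

text \<open>From above, use the path on all vertices, where the bag of a vertex of a block consists
  of the vertex and the hubs of its block. From below, \<open>w < m\<close> makes the vertices up to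
  \<open>w\<close> a clique.\<close>

lemma treewidth_hub_graph:
  assumes "w < m" "0 < k" "k * m \<le> n"
  shows "treewidth (hub_graph w m k n) = w"
proof (rule antisym)
  have n: "0 < n" using assms by (cases n) auto
  define hubs where "hubs v = {u. u div m = v div m \<and> u mod m < w}" for v
  define B where "B v = insert v (if v < k * m then hubs v else {})" for v
  have hubs_lt: "u < k * m" if "u \<in> hubs v" "v < k * m" for u v
    using that assms by (simp add: hubs_def flip: div_less_iff_less_mult)
  have hubs_sub: "hubs v \<subseteq> (\<lambda>a. v div m * m + a) ` {..<w}" for v
  proof
    fix u assume u: "u \<in> hubs v"
    then have "u = v div m * m + u mod m" by (metis (mono_tags, lifting) div_mult_mod_eq hubs_def mem_Collect_eq)
    with u show "u \<in> (\<lambda>a. v div m * m + a) ` {..<w}" by (auto simp: hubs_def)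
  qed
  have finhubs: "finite (hubs v)" for v using hubs_sub finite_subset by blast
  have card_hubs: "card (hubs v) \<le> w" for v
  proof -
    have "card (hubs v) \<le> card ((\<lambda>a. v div m * m + a) ` {..<w})" using hubs_sub by (intro card_mono) auto
    also have "\<dots> \<le> w" using card_image_le[of "{..<w}"] by simp
    finally show ?thesis .
  qed
  have "tree_decomposition (hub_graph w m k n) (path_graph n) B"
    unfolding tree_decomposition_def
  proof (intro conjI ballI)
    show "is_tree (path_graph n)" using n by (rule is_tree_path_graph)
    show "B t \<subseteq> verts (hub_graph w m k n)" if "t \<in> verts (path_graph n)" for t
    proof
      fix u assume "u \<in> B t"
      then have "u = t \<or> u < k * m" using hubs_lt[of u t] by (auto simp: B_def split: if_splits)
      then show "u \<in> verts (hub_graph w m k n)"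
        using that assms(3) by (auto simp: path_graph_def hub_graph_def)
    qed
    show "\<exists>t\<in>verts (path_graph n). v \<in> B t" if "v \<in> verts (hub_graph w m k n)" for v
      using that by (auto simp: B_def path_graph_def hub_graph_def)
    show "\<exists>t\<in>verts (path_graph n). e \<subseteq> B t" if "e \<in> edges (hub_graph w m k n)" for e
    proof -
      obtain u v where "e = {u, v}" "v < k * m" "u div m = v div m" "u mod m < w"
        using \<open>e \<in> edges (hub_graph w m k n)\<close> by (auto simp: hub_graph_def)
      then show ?thesis using assms
        by (intro bexI[of _ v]) (auto simp: B_def hubs_def path_graph_def)
    qed
    show "connected_graph (induced (path_graph n) {t. v \<in> B t})"
      if v: "v \<in> verts (hub_graph w m k n)" for v
    proof -
      define S where "S = {..<n} \<inter> {t. v \<in> B t}"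
      \<comment> \<open>A hub occurs in the bags of its whole block and any other vertex only in its
        own bag, hence always in an interval of the path.\<close>
      have S: "S = (if v < k * m \<and> v mod m < w then {t. t < k * m \<and> t div m = v div m} else {v})"
      proof (cases "v < k * m \<and> v mod m < w")
        case True
        then show ?thesis using assms by (auto simp: S_def B_def hubs_def)
      next
        case False
        then show ?thesis
          using v hubs_lt[of v] by (auto simp: S_def B_def hubs_def hub_graph_def)
      qed
      have "connected_graph (induced (path_graph n) S)"
      proof (rule connected_induced_path)
        show "S \<subseteq> {..<n}" by (simp add: S_def)
        show "S \<noteq> {}" by (auto simp: S)
        show "y \<in> S" if "x \<in> S" "z \<in> S" "x \<le> y" "y \<le> z" for x y z
          using that div_le_mono[of x y m] div_le_mono[of y z m]
          by (auto simp: S split: if_splits)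
      qed
      moreover have "induced (path_graph n) S = induced (path_graph n) {t. v \<in> B t}"
        by (auto simp: induced_def S_def path_graph_def)
      ultimately show ?thesis by simp
    qed
  qed
  moreover have "card (B v) \<le> w + 1" for v
    using card_hubs[of v] finhubs[of v] by (auto simp: B_def card_insert_if)
  ultimately show "treewidth (hub_graph w m k n) \<le> w" by (intro treewidth_le) auto
next
  have "m \<le> k * m" using assms(2) by simp
  then have wk: "w < k * m" using assms(1) by linarith
  have edge: "{u, v} \<in> edges (hub_graph w m k n)" if "u \<in> {..w}" "v \<in> {..w}" "u \<noteq> v" for u v
  proof (cases "u < v")
    case True
    then show ?thesis using that wk assms by (intro hub_edge) auto
  next
    case False
    then have "{v, u} \<in> edges (hub_graph w m k n)" using that wk assms by (intro hub_edge) auto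
    then show ?thesis by (simp add: insert_commute)
  qed
  have "{..w} \<subseteq> verts (hub_graph w m k n)" using wk assms(3) by (auto simp: hub_graph_def)
  then have "card {..w} \<le> treewidth (hub_graph w m k n) + 1"
    using assms edge by (intro clique_le_treewidth finite_simple_hub_graph) auto
  then show "w \<le> treewidth (hub_graph w m k n)" by simp
qed

text \<open>Deleting the chosen vertices one after the other counts every edge at most once.\<close>

lemma card_edges_ge_sum_degrees:
  fixes d :: "nat \<Rightarrow> nat"
  assumes fin: "finite E"
    and deg: "\<And>j D. j < J \<Longrightarrow> finite D \<Longrightarrow> card D \<le> j \<Longrightarrow> \<exists>v. d j \<le> card {e \<in> E. v \<in> e \<and> e \<inter> D = {}}"
  shows "sum d {..<J} \<le> card E"
proof -
  have "i \<le> J \<Longrightarrow> finite D \<Longrightarrow> card D \<le> i \<Longrightarrow> sum d {i..<J} \<le> card {e \<in> E. e \<inter> D = {}}" for i D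
  proof (induction "J - i" arbitrary: i D)
    case (Suc x)
    then have "i < J" by simp
    then obtain v where v: "d i \<le> card {e \<in> E. v \<in> e \<and> e \<inter> D = {}}" using deg Suc by blast
    have "sum d {Suc i..<J} \<le> card {e \<in> E. e \<inter> insert v D = {}}"
      using Suc \<open>i < J\<close> by (intro Suc(1)) (auto simp: card_insert_if)
    then have "sum d {i..<J} \<le> card {e \<in> E. v \<in> e \<and> e \<inter> D = {}} + card {e \<in> E. e \<inter> insert v D = {}}"
      using v \<open>i < J\<close> by (simp add: sum.atLeast_Suc_lessThan)
    also have "\<dots> = card ({e \<in> E. v \<in> e \<and> e \<inter> D = {}} \<union> {e \<in> E. e \<inter> insert v D = {}})"
      using fin by (intro card_Un_disjoint[symmetric]) auto
    also have "{e \<in> E. v \<in> e \<and> e \<inter> D = {}} \<union> {e \<in> E. e \<inter> insert v D = {}} = {e \<in> E. e \<inter> D = {}}"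
      by auto
    finally show ?case .
  qed simp
  from this[of 0 "{}"] show ?thesis by (simp add: atLeast0LessThan)
qed

text \<open>The number of blocks is the least \<open>k\<close> with \<open>j < k * w\<close>. Their
  images are disjoint, so one of them meets \<open>D\<close> in fewer than \<open>w\<close> vertices
  and keeps a hub. If the blocks are not longer than \<open>w\<close>, the claimed degree is
  \<open>0\<close>.\<close>

lemma universal_degree:
  assumes G: "universal_for G (treewidth_graphs w n)" and w: "1 \<le> w"
    and D: "finite D" "card D \<le> j"
  shows "\<exists>v. n div (j div w + 1) - w \<le> card {e \<in> edges G. v \<in> e \<and> e \<inter> D = {}}"
proof (cases "w < n div (j div w + 1)")
  case True
  define k where "k = j div w + 1"
  define m where "m = n div k"
  have m: "w < m" "0 < k" "k * m \<le> n" using True by (simp_all add: m_def k_def del: mult_Suc)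
  have jk: "j < k * w" 
    using w dividend_less_div_times[of w j] unfolding k_def by simp
  have "hub_graph w m k n \<in> treewidth_graphs w n"
    using m by (simp add: treewidth_graphs_def treewidth_hub_graph finite_simple_hub_graph)
      (simp add: hub_graph_def)
  then obtain H' where H': "subgraph H' G" "isomorphic (hub_graph w m k n) H'"
    using G by (auto simp: universal_for_def)
  then obtain f where f: "bij_betw f {..<n} (verts H')"
    and fe: "edges H' = (\<lambda>e. f ` e) ` edges (hub_graph w m k n)"
    by (auto simp: isomorphic_def hub_graph_def)
  have inj: "inj_on f {..<n}" using f by (simp add: bij_betw_def)
  have finE: "finite (edges G)"
  proof -
    have "edges G \<subseteq> Pow (verts G)" "finite (verts G)"
      using H'(1) by (auto simp: subgraph_def finite_simple_graph_def)
    then show ?thesis using finite_subset by blast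
  qed
  define block where "block g = {g * m..<Suc g * m}" for g
  have block_n: "block g \<subseteq> {..<n}" if "g < k" for g
    using that m(3) mult_le_mono1[of "Suc g" k m] by (auto simp: block_def)
  have block_div: "x div m = g" if "x \<in> block g" for x g
    using that by (intro div_nat_eqI) (auto simp: block_def mult.commute)
  have "\<exists>g<k. card (D \<inter> f ` block g) < w"
  proof (rule ccontr)
    assume "\<not> ?thesis"
    then have "(\<Sum>g<k. w) \<le> (\<Sum>g<k. card (D \<inter> f ` block g))"
      by (intro sum_mono) (meson lessThan_iff not_less)
    then have "k * w \<le> (\<Sum>g<k. card (D \<inter> f ` block g))" by simp
    also have "\<dots> = card (\<Union>g<k. D \<inter> f ` block g)"
    proof (rule card_UN_disjoint[symmetric])
      show "\<forall>g\<in>{..<k}. \<forall>h\<in>{..<k}. g \<noteq> h \<longrightarrow> (D \<inter> f ` block g) \<inter> (D \<inter> f ` block h) = {}"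
      proof (intro ballI impI)
        fix g h assume gh: "g \<in> {..<k}" "h \<in> {..<k}" "g \<noteq> h"
        have "block g \<inter> block h = {}"
        proof -
          from block_div[of _ g] block_div[of _ h] gh(3) show ?thesis by auto
        qed
        then have "f ` block g \<inter> f ` block h = {}"
          using inj_on_image_Int[OF inj block_n[of g] block_n[of h]] gh by simp
        then show "(D \<inter> f ` block g) \<inter> (D \<inter> f ` block h) = {}" by blast
      qed
    qed (use D in auto)
    also have "\<dots> \<le> card D" using D by (intro card_mono) auto
    finally show False using D jk by simp
  qed
  then obtain g where g: "g < k" "card (D \<inter> f ` block g) < w" by blast
  have hubs: "{g * m..<g * m + w} \<subseteq> block g" using m by (auto simp: block_def)
  have "\<exists>h\<in>{g * m..<g * m + w}. f h \<notin> D"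
  proof (rule ccontr)
    assume "\<not> ?thesis"
    then have "f ` {g * m..<g * m + w} \<subseteq> D \<inter> f ` block g" using hubs by auto
    then have "card (f ` {g * m..<g * m + w}) \<le> card (D \<inter> f ` block g)" using D by (intro card_mono) auto
    moreover have "inj_on f {g * m..<g * m + w}"
      using inj hubs block_n[OF g(1)] inj_on_subset by blast
    ultimately show False using g by (simp add: card_image)
  qed
  then obtain h where h: "h \<in> {g * m..<g * m + w}" "f h \<notin> D" by blast
  have hb: "h \<in> block g" using h hubs by blast
  define N where "N = block g - {h} - {x \<in> block g. f x \<in> D}"
  have injb: "inj_on f (block g)" using inj block_n[OF g(1)] inj_on_subset by blast
  have "card {x \<in> block g. f x \<in> D} < w"
  proof -
    have "f ` {x \<in> block g. f x \<in> D} = D \<inter> f ` block g" by auto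
    moreover have "inj_on f {x \<in> block g. f x \<in> D}" by (rule inj_on_subset[OF injb]) auto
    ultimately show ?thesis using g(2) card_image by metis
  qed
  moreover have "card (block g) = m" by (simp add: block_def)
  \<comment> \<open>Lost are the hub itself and at most \<open>w - 1\<close> vertices in
    \<open>D\<close>.\<close>
  ultimately have "m - w \<le> card N"
    unfolding N_def using hb h
    by (subst card_Diff_subset) (auto simp: block_def intro: finite_subset[of _ "{g * m..<Suc g * m}"])
  also have "card N = card ((\<lambda>x. {f h, f x}) ` N)"
  proof (rule card_image[symmetric])
    show "inj_on (\<lambda>x. {f h, f x}) N"
    proof (rule inj_onI)
      fix x y assume "x \<in> N" "y \<in> N" "{f h, f x} = {f h, f y}"
      moreover from this have "f x = f y" by (auto simp: doubleton_eq_iff)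
      ultimately show "x = y" using injb by (auto simp: N_def inj_on_def)
    qed
  qed
  also have "\<dots> \<le> card {e \<in> edges G. f h \<in> e \<and> e \<inter> D = {}}"
  proof (rule card_mono)
    show "(\<lambda>x. {f h, f x}) ` N \<subseteq> {e \<in> edges G. f h \<in> e \<and> e \<inter> D = {}}"
    proof clarsimp
      fix x assume x: "x \<in> N"
      have "y < k * m" if "y \<in> block g" for y
        using that g(1) mult_le_mono1[of "Suc g" k m] by (auto simp: block_def)
      moreover have "h mod m < w"
        using h m(1) block_div[OF hb] by (metis add_less_cancel_left atLeastLessThan_iff div_mult_mod_eq)
      ultimately have "{h, x} \<in> edges (hub_graph w m k n)"
        using x hb block_div by (intro hub_edge) (auto simp: N_def)
      then have "f ` {h, x} \<in> edges H'" unfolding fe by (rule imageI)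
      then have "{f h, f x} \<in> edges G" using H'(1) by (auto simp: subgraph_def)
      with x h show "{f h, f x} \<in> edges G \<and> f h \<notin> D \<and> f x \<notin> D" by (auto simp: N_def)
    qed
  qed (use finE in auto)
  finally show ?thesis by (auto simp: m_def k_def)
qed auto

section \<open>Summation of the degrees\<close>

lemma ln_le_harmonic: "ln (real M + 1) \<le> (\<Sum>k<M. 1 / (real k + 1))"
proof (induction M)
  case (Suc M)
  have "ln (real (Suc M) + 1) - ln (real M + 1) = ln (1 + 1 / (real M + 1))"
  proof -
    have "1 + 1 / (real M + 1) = (real (Suc M) + 1) / (real M + 1)" by (simp add: field_simps)
    then show ?thesis using ln_div[of "real (Suc M) + 1" "real M + 1"] by simp
  qed
  also have "\<dots> \<le> 1 / (real M + 1)" by (intro ln_add_one_self_le_self) simp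
  finally show ?case using Suc by simp
qed simp

text \<open>The degree bound after \<open>j\<close> deletions depends only on
  \<open>j div w\<close>, so each number of blocks contributes \<open>w\<close> times.\<close>

lemma sum_blocks:
  fixes f :: "nat \<Rightarrow> 'a::comm_semiring_1"
  shows "(\<Sum>j<w * M. f (j div w)) = (\<Sum>k<M. of_nat w * f k)"
proof (induction M)
  case (Suc M)
  show ?case
  proof (cases "w = 0")
    case False
    have "(\<Sum>j<w * Suc M. f (j div w)) = (\<Sum>j<w * M. f (j div w)) + (\<Sum>j\<in>{w * M..<w * M + w}. f (j div w))"
      unfolding lessThan_atLeast0 by (subst sum.atLeastLessThan_concat) (auto simp: add.commute)
    also have "(\<Sum>j\<in>{w * M..<w * M + w}. f (j div w)) = (\<Sum>j\<in>{w * M..<w * M + w}. f M)"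
      by (intro sum.cong refl arg_cong[of _ _ f] div_nat_eqI) (auto simp: mult.commute)
    finally show ?thesis using Suc by simp
  qed simp
qed simp

lemma real_divide_le_div: "real n / real k \<le> real (n div k) + 1"
  using floor_divide_of_nat_eq[of n k, where 'a = real] by linarith

text \<open>The harmonic sum yields the logarithm. Each of the \<open>M\<close> summands loses
  \<open>1\<close> by rounding and \<open>w\<close> by the subtracted hubs, together at most
  \<open>M * (w + 1) \<le> 2 * n\<close>, whence the constant \<open>2\<close>.\<close>

lemma s_tw_lower:
  assumes w: "1 \<le> w" "w < n"
  shows "real n * real w * ln (real n / real w) - 2 * (real n * real w) \<le> real (s_tw w n)"
proof -
  obtain G :: "nat graph" where G: "finite_simple_graph G" "universal_for G (treewidth_graphs w n)"
    and s: "card (edges G) = s_tw w n"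
    using s_tw_attained[of n w] by blast
  \<comment> \<open>With more than \<open>M\<close> blocks, the blocks would be shorter than
    \<open>w\<close> and contribute nothing.\<close>
  define M where "M = n div w"
  have "edges G \<subseteq> Pow (verts G)" "finite (verts G)" using G by (auto simp: finite_simple_graph_def)
  then have "finite (edges G)" using finite_subset by blast
  then have "(\<Sum>j<w * M. n div (j div w + 1) - w) \<le> s_tw w n"
    unfolding s[symmetric] using universal_degree[OF G(2) w(1)] by (rule card_edges_ge_sum_degrees)
  then have "w * (\<Sum>k<M. n div (k + 1) - w) \<le> s_tw w n"
    using sum_blocks[of "\<lambda>k. n div (k + 1) - w" w M] by (simp add: sum_distrib_left)
  then have le: "real w * (\<Sum>k<M. real (n div (k + 1) - w)) \<le> real (s_tw w n)"
    by (metis of_nat_le_iff of_nat_mult of_nat_sum)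
  have "real n * (1 / (real k + 1)) - (real w + 1) \<le> real (n div (k + 1) - w)" for k
  proof -
    have "real n / real (k + 1) - 1 \<le> real (n div (k + 1))"
      using real_divide_le_div[of n "k + 1"] by linarith
    moreover have "real (n div (k + 1)) - real w \<le> real (n div (k + 1) - w)" by linarith
    ultimately have "real n / real (k + 1) - (real w + 1) \<le> real (n div (k + 1) - w)" by linarith
    then show ?thesis by (simp add: add.commute)
  qed
  then have "(\<Sum>k<M. real n * (1 / (real k + 1)) - (real w + 1)) \<le> (\<Sum>k<M. real (n div (k + 1) - w))"
    by (intro sum_mono)
  then have 1: "real n * (\<Sum>k<M. 1 / (real k + 1)) - real M * (real w + 1) \<le> (\<Sum>k<M. real (n div (k + 1) - w))"
    by (simp add: sum_subtractf sum_distrib_left)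
  have "real n / real w \<le> real M + 1"
    unfolding M_def using real_divide_le_div[of n w] by linarith
  then have "ln (real n / real w) \<le> (\<Sum>k<M. 1 / (real k + 1))"
    using w by (intro order.trans[OF _ ln_le_harmonic]) simp
  then have 2: "real n * ln (real n / real w) \<le> real n * (\<Sum>k<M. 1 / (real k + 1))"
    by (intro mult_left_mono) auto
  have "M * (w + 1) \<le> 2 * n"
  proof -
    have "M * w \<le> n" by (simp add: M_def)
    moreover have "M \<le> n" by (simp add: M_def)
    ultimately show ?thesis by simp
  qed
  then have 3: "real M * (real w + 1) \<le> 2 * real n"
    by (metis of_nat_1 of_nat_add of_nat_le_iff of_nat_mult of_nat_numeral)
  from 1 2 3 have "real n * ln (real n / real w) - 2 * real n \<le> (\<Sum>k<M. real (n div (k + 1) - w))" by linarith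
  then have "real w * (real n * ln (real n / real w) - 2 * real n) \<le> real w * (\<Sum>k<M. real (n div (k + 1) - w))"
    by (intro mult_left_mono) auto
  with le show ?thesis by (simp add: algebra_simps)
qed

section \<open>Filling a sequence of slots\<close>

definition leaves :: "nat option list \<Rightarrow> nat" where
  "leaves xs = length (filter (\<lambda>s. s = None) xs)"

lemma leaves_simps [simp]:
  "leaves [] = 0" "leaves (xs @ ys) = leaves xs + leaves ys"
  "leaves (replicate k None) = k" "leaves (replicate k (Some r)) = 0"
  by (auto simp: leaves_def)

text \<open>
  A list of slots is filled with the vertices of a graph one by one. A slot \<open>None\<close> is a leaf,
  a slot \<open>Some r\<close> is reserved for separators. Time is the number of leaves passed so far, and the
  reach of a slot is the time up to which all neighbours of its vertex must have been placed.
\<close>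

definition slot_time :: "nat option list \<Rightarrow> nat \<Rightarrow> nat" where
  "slot_time xs a = leaves (take a xs)"

definition slot_reach :: "nat \<Rightarrow> nat option list \<Rightarrow> nat \<Rightarrow> nat" where
  "slot_reach R xs a = (case xs ! a of None \<Rightarrow> R | Some r \<Rightarrow> r)"

lemma slot_time_Suc:
  "a < length xs \<Longrightarrow> slot_time xs (Suc a) = slot_time xs a + (if xs ! a = None then 1 else 0)"
  by (simp add: slot_time_def take_Suc_conv_app_nth leaves_def)

lemma slot_time_append: "slot_time (pre @ xs) (length pre) = leaves pre"
  by (simp add: slot_time_def)

locale filling =
  fixes V :: "'a set" and E :: "'a set set" and slots :: "nat option list" and R :: nat
  assumes finite_V: "finite V" and card_V: "card V \<le> length slots"
begin

abbreviation "tm \<equiv> slot_time slots"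
abbreviation "rch \<equiv> slot_reach R slots"

text \<open>
  A state consists of the placed vertices and a chain \<open>\<P>\<close> of sets without edges from their unplaced
  vertices to unplaced vertices outside. Leaves are filled from the smallest set that is not
  exhausted, so that the unplaced part of each \<open>P \<in> \<P>\<close> is finished after at most as many leaves as it
  has elements. This serves as the deadline for the neighbours of a placed vertex.
\<close>

definition good :: "'a list \<Rightarrow> 'a set set \<Rightarrow> bool" where
  "good vs \<P> \<longleftrightarrow> distinct vs \<and> set vs \<subseteq> V \<and> \<P> \<subseteq> Pow V \<and> {} \<in> \<P> \<and> V \<in> \<P> \<and>
     (\<forall>P\<in>\<P>. \<forall>Q\<in>\<P>. P \<subseteq> Q \<or> Q \<subseteq> P) \<and>
     (\<forall>P\<in>\<P>. \<forall>u\<in>P - set vs. \<forall>v\<in>V - P - set vs. {u, v} \<notin> E) \<and>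
     (\<forall>a b. a < b \<longrightarrow> b < length vs \<longrightarrow> {vs ! a, vs ! b} \<in> E \<longrightarrow> tm b \<le> tm a + rch a) \<and>
     (\<forall>a<length vs. \<forall>u\<in>V - set vs. {vs ! a, u} \<in> E \<longrightarrow>
        (\<exists>P\<in>\<P>. u \<in> P \<and> tm (length vs) + card (P - set vs) \<le> tm a + rch a))"

text \<open>Time plus the number of unplaced vertices of \<open>P\<close> is the time by which
  \<open>P\<close> will be finished. An advance may place vertices and add sets to the chain, but it
  never postpones this time for an old set that is not exhausted.\<close>

definition advance :: "'a list \<Rightarrow> 'a set set \<Rightarrow> 'a list \<Rightarrow> 'a set set \<Rightarrow> bool" where
  "advance vs \<P> vs' \<P>' \<longleftrightarrow> good vs' \<P>' \<and> (\<exists>ws. vs' = vs @ ws) \<and> \<P> \<subseteq> \<P>' \<and>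
     (\<forall>P\<in>\<P>. P \<subseteq> set vs' \<or>
        tm (length vs') + card (P - set vs') \<le> tm (length vs) + card (P - set vs))"

lemma good_edge:
  "good vs \<P> \<Longrightarrow> a < b \<Longrightarrow> b < length vs \<Longrightarrow> {vs ! a, vs ! b} \<in> E \<Longrightarrow> tm b \<le> tm a + rch a"
  by (simp add: good_def)

lemma good_deadline:
  assumes "good vs \<P>" "a < length vs" "u \<in> V - set vs" "{vs ! a, u} \<in> E"
  obtains P where "P \<in> \<P>" "u \<in> P" "tm (length vs) + card (P - set vs) \<le> tm a + rch a"
proof -
  have "\<forall>a<length vs. \<forall>u\<in>V - set vs. {vs ! a, u} \<in> E \<longrightarrow>
      (\<exists>P\<in>\<P>. u \<in> P \<and> tm (length vs) + card (P - set vs) \<le> tm a + rch a)"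
    using assms(1) unfolding good_def by (elim conjE)
  with assms(2-) that show ?thesis by blast
qed

lemma good_closed:
  assumes "good vs \<P>" "P \<in> \<P>" "u \<in> P - set vs" "v \<in> V - P - set vs"
  shows "{u, v} \<notin> E"
proof -
  have "\<forall>P\<in>\<P>. \<forall>u\<in>P - set vs. \<forall>v\<in>V - P - set vs. {u, v} \<notin> E"
    using assms(1) unfolding good_def by (elim conjE)
  with assms(2-) show ?thesis by blast
qed

lemma good_chain: "good vs \<P> \<Longrightarrow> P \<in> \<P> \<Longrightarrow> Q \<in> \<P> \<Longrightarrow> P \<subseteq> Q \<or> Q \<subseteq> P"
  by (simp add: good_def)

lemma good_subset: "good vs \<P> \<Longrightarrow> P \<in> \<P> \<Longrightarrow> P \<subseteq> V"
  by (auto simp add: good_def)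

lemma good_basic: "good vs \<P> \<Longrightarrow> distinct vs \<and> set vs \<subseteq> V \<and> {} \<in> \<P> \<and> V \<in> \<P>"
  by (simp add: good_def)

lemma good_init: "good [] {{}, V}"
  by (auto simp: good_def)

lemma advance_refl: "good vs \<P> \<Longrightarrow> advance vs \<P> vs \<P>"
  by (auto simp: advance_def)

lemma advance_good: "advance vs \<P> vs' \<P>' \<Longrightarrow> good vs' \<P>'"
  by (simp add: advance_def)

lemma advance_trans:
  assumes "advance vs \<P> vs' \<P>'" "advance vs' \<P>' vs'' \<P>''"
  shows "advance vs \<P> vs'' \<P>''"
proof -
  have "P \<subseteq> set vs'' \<or> tm (length vs'') + card (P - set vs'') \<le> tm (length vs) + card (P - set vs)"
    if "P \<in> \<P>" for P
  proof -
    have "P \<subseteq> set vs' \<or> tm (length vs') + card (P - set vs') \<le> tm (length vs) + card (P - set vs)"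
      "P \<subseteq> set vs'' \<or> tm (length vs'') + card (P - set vs'') \<le> tm (length vs') + card (P - set vs')"
      using that assms by (auto simp: advance_def)
    moreover have "set vs' \<subseteq> set vs''" using assms by (auto simp: advance_def)
    ultimately show ?thesis by (meson le_trans subset_trans)
  qed
  with assms show ?thesis by (force simp: advance_def)
qed

lemma finite_remaining: "good vs \<P> \<Longrightarrow> P \<in> \<P> \<Longrightarrow> finite (P - set vs)"
  by (rule finite_Diff, rule finite_subset[OF good_subset finite_V])

text \<open>A separator slot takes no time. A leaf takes one unit, which is made up for because its
  vertex lies in all sets that are not exhausted. By closedness the unplaced neighbours of the new
  vertex lie in \<open>P\<^sub>0\<close>, whose remainder is within the reach of the slot.\<close>

lemma place:
  assumes good: "good vs \<P>" and len: "length vs < length slots"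
    and v: "v \<in> P\<^sub>0 - set vs" "P\<^sub>0 \<in> \<P>" "card (P\<^sub>0 - set vs) \<le> rch (length vs)"
    and leaf: "slots ! length vs = None \<Longrightarrow> \<forall>P\<in>\<P>. P \<subseteq> set vs \<or> v \<in> P"
  shows "advance vs \<P> (vs @ [v]) \<P>"
proof -
  have vV: "v \<in> V" using good v by (auto simp: good_def)
  have t: "tm (Suc (length vs)) = tm (length vs) + (if slots ! length vs = None then 1 else 0)"
    using len by (rule slot_time_Suc)
  have rem: "P - set (vs @ [v]) = P - set vs - {v}" for P by auto
  have dec: "tm (Suc (length vs)) + card (P - set (vs @ [v])) \<le> tm (length vs) + card (P - set vs)"
    if P: "P \<in> \<P>" and "\<not> P \<subseteq> set vs" for P
  proof (cases "slots ! length vs = None")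
    case True
    then have "v \<in> P - set vs" using leaf that v by auto
    with finite_remaining[OF good P] have "card (P - set vs) > 0" "card (P - set vs - {v}) = card (P - set vs) - 1"
      by (auto simp: card_gt_0_iff)
    then show ?thesis using t True unfolding rem by simp
  next
    case False
    then have "tm (Suc (length vs)) = tm (length vs)" using t by auto
    then show ?thesis unfolding rem by (simp add: card_Diff1_le)
  qed
  have "good (vs @ [v]) \<P>"
    unfolding good_def
  proof (intro conjI ballI allI impI)
    fix a b assume ab: "a < b" "b < length (vs @ [v])" "{(vs @ [v]) ! a, (vs @ [v]) ! b} \<in> E"
    show "tm b \<le> tm a + rch a"
    proof (cases "b < length vs")
      case True
      then show ?thesis using ab good_edge[OF good, of a b] by (simp add: nth_append)
    next
      case False
      with ab have b: "b = length vs" by simp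
      with ab have "{vs ! a, v} \<in> E" "a < length vs" by (simp_all add: nth_append)
      then obtain P where "tm (length vs) + card (P - set vs) \<le> tm a + rch a"
        using good_deadline[OF good, of a v] v vV by blast
      then show ?thesis using b by simp
    qed
  next
    fix a u assume a: "a < length (vs @ [v])" and u: "u \<in> V - set (vs @ [v])" "{(vs @ [v]) ! a, u} \<in> E"
    show "\<exists>P\<in>\<P>. u \<in> P \<and> tm (length (vs @ [v])) + card (P - set (vs @ [v])) \<le> tm a + rch a"
    proof (cases "a < length vs")
      case True
      then have "{vs ! a, u} \<in> E" using u by (simp add: nth_append)
      then obtain P where P: "P \<in> \<P>" "u \<in> P" "tm (length vs) + card (P - set vs) \<le> tm a + rch a"
        using good_deadline[OF good True, of u] u by auto
      moreover have "\<not> P \<subseteq> set vs" using P u by auto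
      ultimately show ?thesis using dec[of P] by (intro bexI[of _ P]) auto
    next
      case False
      with a have a': "a = length vs" by simp
      with u have "{v, u} \<in> E" by simp
      then have "u \<in> P\<^sub>0" using good_closed[OF good v(2,1), of u] u by auto
      moreover have "\<not> P\<^sub>0 \<subseteq> set vs" using v by auto
      ultimately show ?thesis using dec[of P\<^sub>0] v a' by (intro bexI[of _ P\<^sub>0]) auto
    qed
  next
    show "distinct (vs @ [v])" "set (vs @ [v]) \<subseteq> V" "{} \<in> \<P>" "V \<in> \<P>"
      using good_basic[OF good] v vV by auto
    show "\<P> \<subseteq> Pow V" using good_subset[OF good] by blast
    show "P \<subseteq> Q \<or> Q \<subseteq> P" if "P \<in> \<P>" "Q \<in> \<P>" for P Q using good_chain[OF good that] .
    show "{x, y} \<notin> E" if "P \<in> \<P>" "x \<in> P - set (vs @ [v])" "y \<in> V - P - set (vs @ [v])" for P x y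
      using good_closed[OF good that(1), of x y] that by auto
  qed
  then show ?thesis using dec by (auto simp: advance_def)
qed

lemma place_separators:
  assumes "good vs \<P>" "distinct ys" "set ys \<subseteq> P\<^sub>0 - set vs" "P\<^sub>0 \<in> \<P>" "card (P\<^sub>0 - set vs) \<le> r"
    and "slots = pre @ replicate (length ys) (Some r) @ post" "length pre = length vs"
  shows "advance vs \<P> (vs @ ys) \<P>"
  using assms
proof (induction ys arbitrary: vs pre)
  case Nil
  from advance_refl[OF Nil.prems(1)] show ?case by simp
next
  case (Cons y ys)
  have 1: "advance vs \<P> (vs @ [y]) \<P>"
  proof (rule place)
    show "card (P\<^sub>0 - set vs) \<le> rch (length vs)"
      using Cons.prems by (simp add: slot_reach_def nth_append)
  qed (use Cons.prems in \<open>auto simp: nth_append\<close>)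
  have "advance (vs @ [y]) \<P> ((vs @ [y]) @ ys) \<P>"
  proof (rule Cons.IH)
    show "good (vs @ [y]) \<P>" using 1 by (rule advance_good)
    have "card (P\<^sub>0 - set (vs @ [y])) \<le> card (P\<^sub>0 - set vs)"
      using Cons.prems by (intro card_mono finite_remaining) auto
    then show "card (P\<^sub>0 - set (vs @ [y])) \<le> r" using Cons.prems by simp
    show "slots = (pre @ [Some r]) @ replicate (length ys) (Some r) @ post" using Cons.prems by simp
  qed (use Cons.prems in auto)
  with 1 show ?case using advance_trans by fastforce
qed

text \<open>In a chain a minimal set that is not exhausted lies in all others of this kind, so
  \<open>place\<close> admits its vertices for a leaf.\<close>

lemma smallest_live:
  assumes "good vs \<P>" "set vs \<noteq> V"
  obtains M v where "v \<in> M - set vs" "\<forall>P\<in>\<P>. P \<subseteq> set vs \<or> M \<subseteq> P" "M \<in> \<P>"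
proof -
  define \<L> where "\<L> = {P \<in> \<P>. \<not> P \<subseteq> set vs}"
  have "finite \<P>" using assms(1) finite_V finite_subset[of \<P> "Pow V"] good_subset by blast
  moreover have "V \<in> \<L>" using assms good_basic[OF assms(1)] by (auto simp: \<L>_def)
  moreover have "finite \<L>" using calculation(1) by (simp add: \<L>_def)
  ultimately obtain M where M: "M \<in> \<L>" "\<And>P. P \<in> \<L> \<Longrightarrow> P \<subseteq> M \<Longrightarrow> P = M"
    using finite_has_minimal[of \<L>] by blast
  have "\<forall>P\<in>\<P>. P \<subseteq> set vs \<or> M \<subseteq> P"
    using M good_chain[OF assms(1), of _ M] by (auto simp: \<L>_def)
  moreover obtain v where "v \<in> M - set vs" using M by (auto simp: \<L>_def)
  ultimately show ?thesis using that M by (auto simp: \<L>_def)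
qed

text \<open>The condition under which a stretch of \<open>z\<close> slots can be filled, given the reach \<open>\<rho>\<close>.\<close>

definition reachable :: "nat \<Rightarrow> nat \<Rightarrow> 'a list \<Rightarrow> 'a set set \<Rightarrow> bool" where
  "reachable z \<rho> vs \<P> \<longleftrightarrow>
     (\<exists>P\<in>\<P>. card (P - set vs) \<le> \<rho> \<and> (z \<le> card (P - set vs) \<or> V \<subseteq> P \<union> set vs))"

text \<open>The smallest live set lies in the witness \<open>P\<^sub>0\<close> of
  \<open>reachable\<close>, so its remainder is within the reach. Each leaf takes one vertex from
  \<open>P\<^sub>0\<close> and leaves one slot less to fill, so \<open>P\<^sub>0\<close> remains a
  witness.\<close>

lemma fill_leaves:
  assumes "good vs \<P>" "reachable k \<rho> vs \<P>" "\<rho> \<le> R"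
    and "slots = pre @ replicate k None @ post" "length pre = length vs"
  shows "\<exists>vs'. advance vs \<P> vs' \<P> \<and> (length vs' = length vs + k \<or> set vs' = V)"
  using assms
proof (induction k arbitrary: vs pre)
  case 0
  from advance_refl[OF "0.prems"(1)] show ?case by auto
next
  case (Suc k)
  show ?case
  proof (cases "set vs = V")
    case True
    then show ?thesis using Suc.prems advance_refl by blast
  next
    case False
    obtain P\<^sub>0 where P0: "P\<^sub>0 \<in> \<P>" "card (P\<^sub>0 - set vs) \<le> \<rho>"
      "Suc k \<le> card (P\<^sub>0 - set vs) \<or> V \<subseteq> P\<^sub>0 \<union> set vs"
      using Suc.prems by (auto simp: reachable_def)
    obtain M v where M: "v \<in> M - set vs" "\<forall>P\<in>\<P>. P \<subseteq> set vs \<or> M \<subseteq> P" "M \<in> \<P>"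
      by (rule smallest_live[OF Suc.prems(1) False])
    have "set vs \<subseteq> V" using Suc.prems(1) by (simp add: good_def)
    have "\<not> P\<^sub>0 \<subseteq> set vs"
    proof
      assume "P\<^sub>0 \<subseteq> set vs"
      then have "P\<^sub>0 - set vs = {}" by auto
      with P0(3) have "V \<subseteq> P\<^sub>0 \<union> set vs" by (metis card.empty not_less_eq_eq zero_le)
      with \<open>P\<^sub>0 \<subseteq> set vs\<close> \<open>set vs \<subseteq> V\<close> False show False by blast
    qed
    with M P0 have "M \<subseteq> P\<^sub>0" by blast
    have fin: "finite (P\<^sub>0 - set vs)" using finite_remaining Suc.prems P0 by blast
    have 1: "advance vs \<P> (vs @ [v]) \<P>"
    proof (rule place)
      have "card (M - set vs) \<le> card (P\<^sub>0 - set vs)" using fin \<open>M \<subseteq> P\<^sub>0\<close> by (intro card_mono) auto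
      then show "card (M - set vs) \<le> rch (length vs)"
        using Suc.prems P0 by (simp add: slot_reach_def nth_append)
      show "\<forall>P\<in>\<P>. P \<subseteq> set vs \<or> v \<in> P" using M by blast
    qed (use Suc.prems M in auto)
    have "\<exists>vs'. advance (vs @ [v]) \<P> vs' \<P> \<and> (length vs' = length (vs @ [v]) + k \<or> set vs' = V)"
    proof (rule Suc.IH)
      show "good (vs @ [v]) \<P>" using 1 by (rule advance_good)
      have "P\<^sub>0 - set (vs @ [v]) = P\<^sub>0 - set vs - {v}" by auto
      moreover have "card (P\<^sub>0 - set vs - {v}) = card (P\<^sub>0 - set vs) - 1"
        using M \<open>M \<subseteq> P\<^sub>0\<close> fin by (intro card_Diff_singleton) auto
      ultimately have "card (P\<^sub>0 - set (vs @ [v])) = card (P\<^sub>0 - set vs) - 1" by simp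
      then show "reachable k \<rho> (vs @ [v]) \<P>"
        unfolding reachable_def using P0 by (intro bexI[of _ P\<^sub>0]) auto
      show "slots = (pre @ [None]) @ replicate k None @ post" using Suc.prems by simp
    qed (use Suc.prems in auto)
    then obtain vs' where vs': "advance (vs @ [v]) \<P> vs' \<P>" "length vs' = length (vs @ [v]) + k \<or> set vs' = V"
      by blast
    then show ?thesis using advance_trans[OF 1] by (intro exI[of _ vs']) auto
  qed
qed

lemma good_Un:
  assumes good: "good vs \<P>" and sub: "\<And>Q. Q \<in> \<Q> \<Longrightarrow> Q \<subseteq> V"
    and chain: "\<And>P Q. P \<in> \<P> \<union> \<Q> \<Longrightarrow> Q \<in> \<Q> \<Longrightarrow> P \<subseteq> Q \<or> Q \<subseteq> P"
    and closed: "\<And>Q u v. Q \<in> \<Q> \<Longrightarrow> u \<in> Q - set vs \<Longrightarrow> v \<in> V - Q - set vs \<Longrightarrow> {u, v} \<notin> E"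
  shows "good vs (\<P> \<union> \<Q>)"
  unfolding good_def
proof (intro conjI)
  show "distinct vs" "set vs \<subseteq> V" "{} \<in> \<P> \<union> \<Q>" "V \<in> \<P> \<union> \<Q>" using good_basic[OF good] by auto
  show "\<P> \<union> \<Q> \<subseteq> Pow V" using good_subset[OF good] sub by auto
  show "\<forall>P\<in>\<P> \<union> \<Q>. \<forall>Q\<in>\<P> \<union> \<Q>. P \<subseteq> Q \<or> Q \<subseteq> P" using good_chain[OF good] chain by blast
  show "\<forall>P\<in>\<P> \<union> \<Q>. \<forall>u\<in>P - set vs. \<forall>v\<in>V - P - set vs. {u, v} \<notin> E"
    using good_closed[OF good] closed by blast
  show "\<forall>a b. a < b \<longrightarrow> b < length vs \<longrightarrow> {vs ! a, vs ! b} \<in> E \<longrightarrow> tm b \<le> tm a + rch a"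
    using good_edge[OF good] by blast
  show "\<forall>a<length vs. \<forall>u\<in>V - set vs. {vs ! a, u} \<in> E \<longrightarrow>
      (\<exists>P\<in>\<P> \<union> \<Q>. u \<in> P \<and> tm (length vs) + card (P - set vs) \<le> tm a + rch a)"
    using good_deadline[OF good] by (metis UnI1)
qed

lemma advance_insert:
  assumes "advance vs \<P> vs' \<P>'" "good vs' \<P>''" "\<P>' \<subseteq> \<P>''"
  shows "advance vs \<P> vs' \<P>''"
  using assms(1,3) assms(2) unfolding advance_def by blast

end

section \<open>Cutting a set of the chain by a separator\<close>

text \<open>The assumption \<open>separable\<close> is all that the filling uses of a tree
  decomposition with bags of at most \<open>W\<close> vertices: \<open>X\<close> is the part of a
  bag inside \<open>A\<close>, and the list \<open>cs\<close> of parts begins with a largest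
  one.\<close>

locale separable_filling = filling +
  fixes W :: nat
  assumes separable: "A \<subseteq> V \<Longrightarrow> 1 \<le> \<alpha> \<Longrightarrow> \<alpha> \<le> card A \<Longrightarrow> \<exists>X cs. X \<subseteq> A \<and> card X \<le> W \<and>
    (\<forall>c\<in>set cs. c \<subseteq> A - X \<and> card c < \<alpha> \<and> card c \<le> card (hd cs)) \<and>
    (\<forall>c\<in>set cs. \<forall>u\<in>c. \<forall>v\<in>A - c - X. {u, v} \<notin> E) \<and> \<alpha> \<le> card X + card (\<Union> (set cs))"
begin

lemma place_set:
  assumes "good vs \<P>" "Y \<subseteq> P\<^sub>0 - set vs" "P\<^sub>0 \<in> \<P>" "card (P\<^sub>0 - set vs) \<le> \<rho>" "card Y \<le> W"
    and slots: "slots = pre @ replicate W (Some \<rho>) @ post" "length pre = length vs"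
  shows "\<exists>ys. set ys = Y \<and> length ys = card Y \<and> advance vs \<P> (vs @ ys) \<P>"
proof -
  have "finite Y" using assms(2) finite_remaining[OF assms(1,3)] finite_subset by blast
  then obtain ys where ys: "set ys = Y" "distinct ys" using finite_distinct_list by blast
  have len: "length ys = card Y" using ys distinct_card by metis
  have "slots = pre @ replicate (length ys) (Some \<rho>) @ replicate (W - length ys) (Some \<rho>) @ post"
    using slots len assms(5) by (simp flip: append_assoc replicate_add)
  then have "advance vs \<P> (vs @ ys) \<P>"
    using assms ys by (intro place_separators[where r = \<rho>]) auto
  with ys len show ?thesis by blast
qed

text \<open>The separator is applied to the gap of the chain between the last set with fewer than
  \<open>Z\<close> unplaced vertices and the first with at least \<open>Z\<close>. The parts are
  added to the lower set with a largest part first. When the union reaches a given size, it either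
  is still below \<open>Z\<close>, namely after the first part, or has at most doubled, since the
  new part is no larger than the first.\<close>

lemma cut:
  assumes good: "good vs \<P>" and reach: "reachable Z \<rho> vs \<P>" and WZ: "W \<le> Z" "0 < Z"
    and slots: "slots = pre @ replicate W (Some \<rho>) @ post" "length pre = length vs"
  shows "\<exists>vs\<^sub>1 \<P>\<^sub>1. advance vs \<P> vs\<^sub>1 \<P>\<^sub>1 \<and> (set vs\<^sub>1 = V \<or> length vs\<^sub>1 = length vs + W \<and>
    (\<forall>y\<le>Z - W. reachable y (max Z (2 * (W + y))) vs\<^sub>1 \<P>\<^sub>1))"
proof -
  obtain P\<^sub>0 where P0: "P\<^sub>0 \<in> \<P>" "card (P\<^sub>0 - set vs) \<le> \<rho>" "Z \<le> card (P\<^sub>0 - set vs) \<or> V \<subseteq> P\<^sub>0 \<union> set vs"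
    using reach by (auto simp: reachable_def)
  have fin: "finite (P - set vs)" if "P \<in> \<P>" for P using finite_remaining[OF good that] .
  have basic: "set vs \<subseteq> V" "{} \<in> \<P>" "V \<in> \<P>" using good_basic[OF good] by auto
  have fin\<P>: "finite \<P>" using finite_V finite_subset[of \<P> "Pow V"] good_subset[OF good] by blast
  show ?thesis
  proof (cases "\<exists>P\<in>\<P>. Z \<le> card (P - set vs)")
    case False
    \<comment> \<open>Here everything left amounts to fewer than \<open>Z\<close> vertices, and
      \<open>V\<close> itself serves for every \<open>y\<close>.\<close>
    then have "V \<subseteq> P\<^sub>0 \<union> set vs" using P0 by blast
    then have "card (V - set vs) \<le> card (P\<^sub>0 - set vs)" using fin P0 by (intro card_mono) auto
    then have V\<rho>: "card (V - set vs) \<le> \<rho>" using P0 by simp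
    have VZ: "card (V - set vs) < Z" using False basic by (meson not_le)
    show ?thesis
    proof (cases "W \<le> card (V - set vs)")
      case True
      then obtain Y where Y: "Y \<subseteq> V - set vs" "card Y = W"
        using obtain_subset_with_card_n by metis
      then obtain ys where ys: "set ys = Y" "length ys = card Y" "advance vs \<P> (vs @ ys) \<P>"
        using place_set[OF good Y(1) basic(3) V\<rho> _ slots] by auto
      have "card (V - set (vs @ ys)) \<le> card (V - set vs)"
        using finite_V by (intro card_mono) auto
      then have "reachable y (max Z (2 * (W + y))) (vs @ ys) \<P>" for y
        unfolding reachable_def using basic VZ by (intro bexI[of _ V]) auto
      with ys Y show ?thesis by (intro exI[of _ "vs @ ys"] exI[of _ \<P>]) auto
    next
      case False
      then obtain ys where "set ys = V - set vs" "advance vs \<P> (vs @ ys) \<P>"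
        using place_set[OF good subset_refl basic(3) V\<rho> _ slots] by auto
      with basic show ?thesis by (intro exI[of _ "vs @ ys"] exI[of _ \<P>]) auto
    qed
  next
    case True
    define \<A> where "\<A> = {P \<in> \<P>. Z \<le> card (P - set vs)}"
    have "finite \<A>" "\<A> \<noteq> {}" using fin\<P> True by (auto simp: \<A>_def)
    then obtain Pp where Pp: "Pp \<in> \<A>" "\<And>P. P \<in> \<A> \<Longrightarrow> P \<subseteq> Pp \<Longrightarrow> Pp = P"
      using finite_has_minimal[of \<A>] by blast
    define \<B> where "\<B> = {P \<in> \<P>. card (P - set vs) < Z}"
    have "finite \<B>" "{} \<in> \<B>" using fin\<P> basic WZ by (auto simp: \<B>_def)
    then obtain Pm where Pm: "Pm \<in> \<B>" "\<And>P. P \<in> \<B> \<Longrightarrow> Pm \<subseteq> P \<Longrightarrow> Pm = P"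
      using finite_has_maximal[of \<B>] by blast
    have PP: "Pp \<in> \<P>" "Z \<le> card (Pp - set vs)" "Pm \<in> \<P>" "card (Pm - set vs) < Z"
      using Pp(1) Pm(1) by (auto simp: \<A>_def \<B>_def)
    have above: "Pp \<subseteq> P" if "P \<in> \<P>" "Z \<le> card (P - set vs)" for P
      using that Pp good_chain[OF good, of P Pp] by (auto simp: \<A>_def)
    have below: "P \<subseteq> Pm" if "P \<in> \<P>" "card (P - set vs) < Z" for P
      using that Pm good_chain[OF good, of P Pm] by (auto simp: \<B>_def)
    have "Pm \<subseteq> Pp"
    proof (rule ccontr)
      assume "\<not> Pm \<subseteq> Pp"
      then have "Pp \<subseteq> Pm" using good_chain[OF good, of Pp Pm] PP by blast
      then have "card (Pp - set vs) \<le> card (Pm - set vs)" using fin PP by (intro card_mono) auto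
      with PP show False by simp
    qed
    have Pp\<rho>: "card (Pp - set vs) \<le> \<rho>"
    proof -
      have "Pp - set vs \<subseteq> P\<^sub>0 - set vs"
        using P0(3) above[OF P0(1)] good_subset[OF good PP(1)] by blast
      then have "card (Pp - set vs) \<le> card (P\<^sub>0 - set vs)" using fin P0 by (intro card_mono) auto
      with P0 show ?thesis by simp
    qed
    define A where "A = Pp - Pm - set vs"
    define x where "x = card (Pm - set vs)"
    have AV: "A \<subseteq> V" using good_subset[OF good PP(1)] by (auto simp: A_def)
    have "A = (Pp - set vs) - (Pm - set vs)" by (auto simp: A_def)
    then have "card A = card (Pp - set vs) - x"
      unfolding x_def using \<open>Pm \<subseteq> Pp\<close> fin PP by (simp add: card_Diff_subset Diff_mono)
    with PP have "1 \<le> Z - x" "Z - x \<le> card A" by (auto simp: x_def)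
    then obtain X cs where X: "X \<subseteq> A" "card X \<le> W" "Z - x \<le> card X + card (\<Union> (set cs))"
      and cs: "\<And>c. c \<in> set cs \<Longrightarrow> c \<subseteq> A - X \<and> card c < Z - x \<and> card c \<le> card (hd cs)"
      and nb: "\<And>c u v. c \<in> set cs \<Longrightarrow> u \<in> c \<Longrightarrow> v \<in> A - c - X \<Longrightarrow> {u, v} \<notin> E"
      using separable[OF AV, of "Z - x"] by metis
    have "W \<le> card (Pp - set vs)" using WZ PP by simp
    \<comment> \<open>The separator is padded to exactly \<open>W\<close> vertices, so that all
      separator slots are used.\<close>
    then obtain Y where Y: "X \<subseteq> Y" "Y \<subseteq> Pp - set vs" "card Y = W"
      using exists_subset_between[of X W "Pp - set vs"] X fin PP by (auto simp: A_def)
    then obtain ys where ys: "set ys = Y" "length ys = card Y" "advance vs \<P> (vs @ ys) \<P>"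
      using place_set[OF good Y(2) PP(1) Pp\<rho> _ slots] by auto
    define vs1 where "vs1 = vs @ ys"
    have good1: "good vs1 \<P>" using ys advance_good by (simp add: vs1_def)
    define Q where "Q r = Pm \<union> \<Union> (set (take r cs))" for r
    define \<P>1 where "\<P>1 = \<P> \<union> range Q"
    have QP: "Q r \<subseteq> Pp" "Pm \<subseteq> Q r" for r
      using cs \<open>Pm \<subseteq> Pp\<close> set_take_subset[of r cs] by (fastforce simp: Q_def A_def)+
    have Qmono: "Q r \<subseteq> Q r'" if "r \<le> r'" for r r'
      unfolding Q_def using set_take_subset_set_take[OF that, of cs] by blast
    have "good vs1 \<P>1"
      unfolding \<P>1_def
    proof (rule good_Un[OF good1])
      show "R \<subseteq> V" if "R \<in> range Q" for R
        using that QP(1) good_subset[OF good PP(1)] by blast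
      show "P \<subseteq> R \<or> R \<subseteq> P" if R: "P \<in> \<P> \<union> range Q" "R \<in> range Q" for P R
      proof (cases "P \<in> \<P>")
        case True
        then have "P \<subseteq> Pm \<or> Pp \<subseteq> P" using above[OF True] below[OF True] by linarith
        with QP R(2) show ?thesis by blast
      next
        case False
        then obtain r r' where r: "P = Q r" "R = Q r'" using R by auto
        then show ?thesis using Qmono[of r r'] Qmono[of r' r] linear[of r r'] by blast
      qed
      show "{u, v} \<notin> E" if R: "R \<in> range Q" and u: "u \<in> R - set vs1" and v: "v \<in> V - R - set vs1" for R u v
      proof -
        obtain r where r: "R = Q r" using R by auto
        have vm: "v \<in> V - Pm - set vs1" using v r QP(2)[of r] by blast
        show ?thesis
        proof (cases "u \<in> Pm")
          case True
          then show ?thesis using good_closed[OF good1 PP(3) _ vm, of u] u by blast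
        next
          case False
          then obtain c where c: "c \<in> set cs" "u \<in> c" "c \<subseteq> R"
            using u set_take_subset[of r cs] unfolding r Q_def by blast
          show ?thesis
          proof (cases "v \<in> Pp")
            case True
            then have "v \<in> A - c - X" using v vm c Y ys by (auto simp: A_def vs1_def)
            then show ?thesis using nb c by blast
          next
            case False
            then show ?thesis using good_closed[OF good1 PP(1), of u v] u v r QP(1)[of r] by blast
          qed
        qed
      qed
    qed
    then have adv: "advance vs \<P> vs1 \<P>1"
      using advance_insert[OF ys(3)] by (simp add: \<P>1_def vs1_def)
    have finQ: "finite (Q r - set vs)" for r
      by (rule finite_subset[OF Diff_mono[OF QP(1) subset_refl] fin[OF PP(1)]])
    have QX: "Q r \<inter> X = {}" for r
      using cs X(1) set_take_subset[of r cs] by (fastforce simp: Q_def A_def)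
    have size_le: "card (Q r - set vs1) \<le> card (Q r - set vs)" for r
      using finQ by (intro card_mono) (auto simp: vs1_def)
    have finY: "finite Y" using ys by auto
    \<comment> \<open>The sets \<open>Q r\<close> avoid \<open>X\<close>, so placing
      \<open>Y\<close> takes at most the \<open>W - card X\<close> padding vertices from
      them.\<close>
    have size_ge: "card (Q r - set vs) \<le> card (Q r - set vs1) + (W - card X)" for r
    proof -
      have "Q r - set vs1 = (Q r - set vs) - (Y - X)" using QX[of r] ys by (auto simp: vs1_def)
      moreover have "card (Y - X) = W - card X" using Y finY by (simp add: card_Diff_subset finite_subset)
      ultimately show ?thesis
        using diff_card_le_card_Diff[of "Y - X" "Q r - set vs"] finY by simp
    qed
    have csd: "c \<inter> Pm = {}" "c \<inter> set vs = {}" "finite c" if "c \<in> set cs" for c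
    proof -
      have "c \<subseteq> A" using cs[OF that] by blast
      then show "c \<inter> Pm = {}" "c \<inter> set vs = {}" by (auto simp: A_def)
      show "finite c" using \<open>c \<subseteq> A\<close> AV finite_V by (meson finite_subset)
    qed
    have full: "Z - card X \<le> card (Q (length cs) - set vs)"
    proof -
      have "Q (length cs) - set vs = (Pm - set vs) \<union> \<Union> (set cs)" using csd by (auto simp: Q_def)
      moreover have "card ((Pm - set vs) \<union> \<Union> (set cs)) = x + card (\<Union> (set cs))"
        unfolding x_def using csd fin PP by (intro card_Un_disjoint) auto
      ultimately show ?thesis using X(3) by simp
    qed
    have "reachable y (max Z (2 * (W + y))) vs1 \<P>1" if y: "y \<le> Z - W" for y
    proof -
      \<comment> \<open>The target exceeds \<open>y\<close> by the \<open>W - card X\<close>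
        vertices that the padding may take away, and \<open>y \<le> Z - W\<close> ensures that the
        union of all parts attains it.\<close>
      define u where "u = W + y - card X"
      define r where "r = (LEAST r. u \<le> card (Q r - set vs))"
      have "u \<le> card (Q (length cs) - set vs)" using full y WZ by (simp add: u_def)
      then have r: "u \<le> card (Q r - set vs)" unfolding r_def by (rule LeastI)
      have "y \<le> card (Q r - set vs1)" using r size_ge[of r] X(2) unfolding u_def by linarith
      moreover have "card (Q r - set vs) \<le> max Z (2 * (W + y))"
      proof (cases r)
        case 0
        then show ?thesis using PP by (simp add: Q_def)
      next
        case (Suc r')
        then have r': "card (Q r' - set vs) < u"
          using not_less_Least[of r' "\<lambda>r. u \<le> card (Q r - set vs)"] by (simp add: r_def)
        show ?thesis
        proof (cases "r' < length cs")
          case False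
          then have "Q r = Q r'" using Suc by (simp add: Q_def)
          then show ?thesis using r r' by simp
        next
          case True
          then have "Q r - set vs \<subseteq> (Q r' - set vs) \<union> cs ! r'"
            using Suc by (auto simp: Q_def take_Suc_conv_app_nth)
          then have "card (Q r - set vs) \<le> card ((Q r' - set vs) \<union> cs ! r')"
            using finQ csd True by (intro card_mono) auto
          also have "\<dots> \<le> card (Q r' - set vs) + card (cs ! r')" by (rule card_Un_le)
          finally have le: "card (Q r - set vs) \<le> card (Q r' - set vs) + card (cs ! r')" .
          have c: "cs ! r' \<in> set cs" using True by simp
          show ?thesis
          proof (cases r')
            case 0
            then have "card (Q r' - set vs) = x" by (simp add: Q_def x_def)
            with le cs[OF c] have "card (Q r - set vs) \<le> Z" by linarith
            then show ?thesis by (rule max.coboundedI1)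
          next
            case (Suc r'')
            \<comment> \<open>The largest part is already in \<open>Q r'\<close>, so the next part
              at most doubles the union.\<close>
            have "hd cs \<in> set (take r' cs)" using True Suc by (cases cs) auto
            moreover have "hd cs \<in> set cs" using True by (cases cs) auto
            ultimately have "hd cs \<subseteq> Q r' - set vs" using csd by (auto simp: Q_def)
            then have "card (hd cs) \<le> card (Q r' - set vs)" using finQ by (intro card_mono) auto
            then have "card (Q r - set vs) \<le> 2 * u" using le cs[OF c] r' by simp
            also have "2 * u \<le> 2 * (W + y)" by (simp add: u_def)
            finally show ?thesis by (rule max.coboundedI2)
          qed
        qed
      qed
      ultimately show ?thesis
        unfolding reachable_def \<P>1_def using size_le[of r] by (intro bexI[of _ "Q r"]) auto
    qed
    with adv ys Y show ?thesis by (intro exI[of _ vs1] exI[of _ \<P>1]) (auto simp: vs1_def)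
  qed
qed

definition fillable :: "nat option list \<Rightarrow> nat \<Rightarrow> bool" where
  "fillable xs \<rho> \<longleftrightarrow> (\<forall>vs \<P> pre post. good vs \<P> \<longrightarrow> reachable (length xs) \<rho> vs \<P> \<longrightarrow>
     slots = pre @ xs @ post \<longrightarrow> length pre = length vs \<longrightarrow>
     (\<exists>vs' \<P>'. advance vs \<P> vs' \<P>' \<and> (set vs' = V \<or> length vs' = length vs + length xs)))"

text \<open>When the child starts, \<open>leaves mid\<close> units of time have passed, so the set
  that \<open>base\<close> provides for the end of the child has at most \<rho> unplaced vertices
  left. At most \<open>length mid\<close> vertices were placed meanwhile, so enough remain for the
  child.\<close>

lemma fill_child:
  assumes fill: "fillable xs \<rho>"
    and base: "\<forall>y\<le>M. reachable y (max Z (2 * (W + y))) vs\<^sub>1 \<P>\<^sub>1"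
    and cur: "advance vs\<^sub>1 \<P>\<^sub>1 vs\<^sub>2 \<P>\<^sub>2" "set vs\<^sub>2 = V \<or> length vs\<^sub>2 = length vs\<^sub>1 + length mid"
    and slots: "slots = pre @ mid @ xs @ post" "length pre = length vs\<^sub>1"
    and M: "length mid + length xs \<le> M"
    and \<rho>: "max Z (2 * (W + length mid + length xs)) \<le> \<rho> + leaves mid"
  shows "\<exists>vs\<^sub>3 \<P>\<^sub>3. advance vs\<^sub>1 \<P>\<^sub>1 vs\<^sub>3 \<P>\<^sub>3 \<and>
    (set vs\<^sub>3 = V \<or> length vs\<^sub>3 = length vs\<^sub>1 + length (mid @ xs))"
proof (cases "set vs\<^sub>2 = V")
  case False
  with cur have len: "length vs\<^sub>2 = length vs\<^sub>1 + length mid" by blast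
  have good2: "good vs\<^sub>2 \<P>\<^sub>2" using cur(1) by (rule advance_good)
  obtain ws where ws: "vs\<^sub>2 = vs\<^sub>1 @ ws" using cur by (auto simp: advance_def)
  have tm: "tm (length vs\<^sub>1) = leaves pre" "tm (length vs\<^sub>2) = leaves pre + leaves mid"
    using slot_time_append[of pre "mid @ xs @ post"] slot_time_append[of "pre @ mid" "xs @ post"]
      slots len by auto
  define y where "y = length mid + length xs"
  obtain P where P: "P \<in> \<P>\<^sub>1" "card (P - set vs\<^sub>1) \<le> max Z (2 * (W + y))"
    "y \<le> card (P - set vs\<^sub>1) \<or> V \<subseteq> P \<union> set vs\<^sub>1"
    using base M unfolding y_def reachable_def by meson
  have "P \<in> \<P>\<^sub>2" using P cur by (auto simp: advance_def)
  moreover have "card (P - set vs\<^sub>2) \<le> \<rho>"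
  proof (cases "P \<subseteq> set vs\<^sub>2")
    case True
    then have "P - set vs\<^sub>2 = {}" by blast
    then show ?thesis by (metis card.empty zero_le)
  next
    case False
    then have "tm (length vs\<^sub>2) + card (P - set vs\<^sub>2) \<le> tm (length vs\<^sub>1) + card (P - set vs\<^sub>1)"
      using cur P by (auto simp: advance_def)
    moreover have "card (P - set vs\<^sub>1) \<le> \<rho> + leaves mid"
      using order_trans[OF P(2)] \<rho> by (simp only: y_def add.assoc)
    ultimately show ?thesis using tm by linarith
  qed
  moreover have "length xs \<le> card (P - set vs\<^sub>2) \<or> V \<subseteq> P \<union> set vs\<^sub>2"
  proof (cases "V \<subseteq> P \<union> set vs\<^sub>1")
    case False
    have "P - set vs\<^sub>2 = P - set vs\<^sub>1 - set ws" using ws by auto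
    then have "card (P - set vs\<^sub>1) \<le> card (P - set vs\<^sub>2) + card (set ws)"
      using diff_card_le_card_Diff[of "set ws" "P - set vs\<^sub>1"] by simp
    moreover have "card (set ws) \<le> length mid" using len ws card_length[of ws] by simp
    ultimately show ?thesis using P False by (simp add: y_def)
  qed (use ws in auto)
  ultimately have "reachable (length xs) \<rho> vs\<^sub>2 \<P>\<^sub>2" by (auto simp: reachable_def)
  moreover have "slots = (pre @ mid) @ xs @ post" "length (pre @ mid) = length vs\<^sub>2"
    using slots len by simp_all
  ultimately obtain vs3 \<P>3 where 3: "advance vs\<^sub>2 \<P>\<^sub>2 vs3 \<P>3"
    "set vs3 = V \<or> length vs3 = length vs\<^sub>2 + length xs"
    using fill good2 unfolding fillable_def by blast
  then show ?thesis using advance_trans[OF cur(1) 3(1)] len by (intro exI[of _ vs3] exI[of _ \<P>3]) auto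
qed (use cur in blast)

end

section \<open>The universal graph\<close>

text \<open>A node of level \<open>i + 3\<close> has two children of level \<open>i + 1\<close> and
  two of level \<open>i\<close>, so lengths grow like powers of the real root, about 1.7693, of
  \<open>x ^ 3 = 2 * x + 2\<close>. The initial values keep the ratio of consecutive lengths at most
  11 / 6.\<close>

fun leaf_len :: "nat \<Rightarrow> nat \<Rightarrow> nat" where
  "leaf_len l 0 = 4 * l"
| "leaf_len l (Suc 0) = 7 * l"
| "leaf_len l (Suc (Suc 0)) = 12 * l"
| "leaf_len l (Suc (Suc (Suc i))) = 2 * leaf_len l (Suc i) + 2 * leaf_len l i"

fun node_len :: "nat \<Rightarrow> nat \<Rightarrow> nat \<Rightarrow> nat" where
  "node_len W l 0 = 4 * l"
| "node_len W l (Suc 0) = 7 * l"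
| "node_len W l (Suc (Suc 0)) = 12 * l"
| "node_len W l (Suc (Suc (Suc i))) = W + 2 * node_len W l (Suc i) + 2 * node_len W l i"

text \<open>
  The reaches of the children are \<open>max Z (2 * (W + y)) - o\<close>, or a little more, where \<open>Z\<close> is the length
  of the node, \<open>o\<close> the number of leaves before the child, and \<open>y\<close> the number of slots from the end of
  the separators to the end of the child. The ratio of large to small children is about \<open>1.77\<close>, for
  which the total reach is close to minimal.
\<close>

fun node_slots :: "nat \<Rightarrow> nat \<Rightarrow> nat \<Rightarrow> nat \<Rightarrow> nat option list" where
  "node_slots W l 0 \<rho> = replicate (4 * l) None"
| "node_slots W l (Suc 0) \<rho> = replicate (7 * l) None"
| "node_slots W l (Suc (Suc 0)) \<rho> = replicate (12 * l) None"
| "node_slots W l (Suc (Suc (Suc i))) \<rho> =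
    (let p = leaf_len l (Suc i); q = leaf_len l i; P = node_len W l (Suc i); Q = node_len W l i;
       Z = W + 2 * P + 2 * Q
     in replicate W (Some \<rho>) @ node_slots W l (Suc i) (Z + W) @ node_slots W l i (Z + W - p)
       @ node_slots W l i (2 * (W + P + 2 * Q) - (p + q))
       @ node_slots W l (Suc i) (2 * Z - (p + 2 * q)))"

lemma length_node_slots [simp]: "length (node_slots W l i \<rho>) = node_len W l i"
  by (induction W l i \<rho> rule: node_slots.induct) (simp_all add: Let_def)

lemma leaves_node_slots [simp]: "leaves (node_slots W l i \<rho>) = leaf_len l i"
  by (induction W l i \<rho> rule: node_slots.induct) (simp_all add: Let_def)

lemma leaf_len_le_node_len: "leaf_len l i \<le> node_len W l i"
  by (induction l i rule: leaf_len.induct) auto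

context separable_filling
begin

text \<open>Levels below \<open>3\<close> are runs of leaves. A higher node places its separators by
  \<open>cut\<close> and then fills its four children in turn by \<open>fill_child\<close>.\<close>

lemma fill_node:
  assumes W: "0 < W" and R: "\<And>i. i < 6 \<Longrightarrow> 2 * node_len W l i \<le> R"
    and "i < 3 \<longrightarrow> \<rho> \<le> R"
  shows "fillable (node_slots W l i \<rho>) \<rho>"
  using assms(3)
proof (induction i arbitrary: \<rho> rule: less_induct)
  case (less i)
  have "\<exists>vs' \<P>'. advance vs \<P> vs' \<P>' \<and> (set vs' = V \<or> length vs' = length vs + node_len W l i)"
    if prems: "good vs \<P>" "reachable (node_len W l i) \<rho> vs \<P>"
      "slots = pre @ node_slots W l i \<rho> @ post" "length pre = length vs" for vs \<P> pre post
  proof (cases "i < 3")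
    case True
    then have "node_slots W l i \<rho> = replicate (node_len W l i) None"
      by (auto simp: less_Suc_eq numeral_3_eq_3)
    moreover from this have "slots = pre @ replicate (node_len W l i) None @ post" using prems(3) by simp
    ultimately show ?thesis using fill_leaves[OF prems(1,2)] less.prems prems(4) True by blast
  next
    case False
    define j where "j = i - 3"
    have i: "i = Suc (Suc (Suc j))" using False by (simp add: j_def)
    define p q P Q Z where "p = leaf_len l (Suc j)" "q = leaf_len l j"
      "P = node_len W l (Suc j)" "Q = node_len W l j" "Z = W + 2 * P + 2 * Q"
    note defs = this
    have Z: "node_len W l i = Z" by (simp add: i defs)
    \<comment> \<open>A run of leaves is a child only of nodes of level below \<open>6\<close>, and
      no child gets a reach above \<open>2 * Z\<close>; hence the bound on \<open>R\<close> concerns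
      these levels.\<close>
    have small: "c < 3 \<longrightarrow> \<rho>' \<le> R" if "\<rho>' \<le> 2 * Z" "c = j \<or> c = Suc j" for c \<rho>'
      using that R[of i] Z i by auto
    define x0 x1 x2 x3 where "x0 = node_slots W l (Suc j) (Z + W)"
      "x1 = node_slots W l j (Z + W - p)" "x2 = node_slots W l j (2 * (W + P + 2 * Q) - (p + q))"
      "x3 = node_slots W l (Suc j) (2 * Z - (p + 2 * q))"
    note xdefs = this
    have slots: "slots = pre @ replicate W (Some \<rho>) @ x0 @ x1 @ x2 @ x3 @ post"
      using prems(3) by (simp add: i xdefs Let_def defs)
    have len: "length x0 = P" "length x1 = Q" "length x2 = Q" "length x3 = P"
      by (simp_all add: xdefs defs)
    have lvs: "leaves x0 = p" "leaves x1 = q" "leaves x2 = q" "leaves x3 = p"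
      by (simp_all add: xdefs defs)
    have fill: "fillable x \<rho>'"
      if "x = node_slots W l c \<rho>'" "c = j \<or> c = Suc j" "\<rho>' \<le> 2 * Z" for x c \<rho>'
      using that less.IH[of c \<rho>'] small[of \<rho>' c] by (auto simp: i)
    have "reachable Z \<rho> vs \<P>" "W \<le> Z" "0 < Z" using prems(2) W Z by (simp_all add: defs(5))
    from cut[OF prems(1) this slots prems(4)]
    obtain vs1 \<P>1 where 1: "advance vs \<P> vs1 \<P>1"
      and base: "set vs1 = V \<or> length vs1 = length vs + W \<and>
        (\<forall>y\<le>Z - W. reachable y (max Z (2 * (W + y))) vs1 \<P>1)"
      by blast
    show ?thesis
    proof (cases "set vs1 = V")
      case True
      with 1 show ?thesis by blast
    next
      case False
      with base have len1: "length vs1 = length vs + W"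
        and base: "\<forall>y\<le>Z - W. reachable y (max Z (2 * (W + y))) vs1 \<P>1" by auto
      define pre1 where "pre1 = pre @ replicate W (Some \<rho>)"
      have pre1: "length pre1 = length vs1" using prems len1 by (simp add: pre1_def)
      have slots1: "slots = pre1 @ x0 @ x1 @ x2 @ x3 @ post" using slots by (simp add: pre1_def)
      have adv1: "advance vs1 \<P>1 vs1 \<P>1" using 1 advance_good advance_refl by blast
      have ZW: "Z - W = 2 * P + 2 * Q" by (simp add: defs)
      have le: "p \<le> P" "q \<le> Q" by (simp_all add: defs leaf_len_le_node_len)
      note bounds = defs(5) len lvs ZW le
      have f: "Z + W \<le> 2 * Z" "Z + W - p \<le> 2 * Z" "2 * (W + P + 2 * Q) - (p + q) \<le> 2 * Z"
        "2 * Z - (p + 2 * q) \<le> 2 * Z"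
        by (simp_all add: defs(5))
      \<comment> \<open>As \<open>Z = W + 2 * P + 2 * Q\<close>, the maxima required by
        \<open>fill_child\<close> are at most \<open>Z + W\<close> for the first child and equal to
        \<open>Z + W\<close>, \<open>2 * (W + P + 2 * Q)\<close> and \<open>2 * Z\<close> for the
        others. The leaves passed are subtracted from these to get the reaches.\<close>
      have "set vs1 = V \<or> length vs1 = length vs1 + length []"
        "slots = pre1 @ [] @ x0 @ x1 @ x2 @ x3 @ post"
        "length [] + length x0 \<le> Z - W" "max Z (2 * (W + length [] + length x0)) \<le> Z + W + leaves []"
        using slots1 by (simp_all add: bounds)
      from fill_child[OF fill[OF xdefs(1) disjI2[OF refl] f(1)] base adv1 this(1,2) pre1 this(3,4)]
      obtain vs2 \<P>2 where 2: "advance vs1 \<P>1 vs2 \<P>2" "set vs2 = V \<or> length vs2 = length vs1 + length x0"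
        by auto
      have "length x0 + length x1 \<le> Z - W"
        "max Z (2 * (W + length x0 + length x1)) \<le> Z + W - p + leaves x0"
        using le by (simp_all add: bounds)
      from fill_child[OF fill[OF xdefs(2) disjI1[OF refl] f(2)] base 2 slots1 pre1 this]
      obtain vs3 \<P>3 where 3: "advance vs1 \<P>1 vs3 \<P>3" "set vs3 = V \<or> length vs3 = length vs1 + length (x0 @ x1)"
        by blast
      have "slots = pre1 @ (x0 @ x1) @ x2 @ x3 @ post"
        "length (x0 @ x1) + length x2 \<le> Z - W"
        "max Z (2 * (W + length (x0 @ x1) + length x2)) \<le> 2 * (W + P + 2 * Q) - (p + q) + leaves (x0 @ x1)"
        using slots1 le by (simp_all add: bounds)
      from fill_child[OF fill[OF xdefs(3) disjI1[OF refl] f(3)] base 3 this(1) pre1 this(2,3)]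
      obtain vs4 \<P>4 where 4: "advance vs1 \<P>1 vs4 \<P>4" "set vs4 = V \<or> length vs4 = length vs1 + length ((x0 @ x1) @ x2)"
        by blast
      have "slots = pre1 @ ((x0 @ x1) @ x2) @ x3 @ post"
        "length ((x0 @ x1) @ x2) + length x3 \<le> Z - W"
        "max Z (2 * (W + length ((x0 @ x1) @ x2) + length x3)) \<le> 2 * Z - (p + 2 * q) + leaves ((x0 @ x1) @ x2)"
        using slots1 le by (simp_all add: bounds)
      from fill_child[OF fill[OF xdefs(4) disjI2[OF refl] f(4)] base 4 this(1) pre1 this(2,3)]
      obtain vs5 \<P>5 where 5: "advance vs1 \<P>1 vs5 \<P>5"
        "set vs5 = V \<or> length vs5 = length vs1 + length (((x0 @ x1) @ x2) @ x3)"
        by blast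
      have "advance vs \<P> vs5 \<P>5" using 1 5(1) by (rule advance_trans)
      moreover have "set vs5 = V \<or> length vs5 = length vs + node_len W l i"
        using 5(2) len1 Z by (auto simp: bounds)
      ultimately show ?thesis by blast
    qed
  qed
  then show ?case unfolding fillable_def length_node_slots by blast
qed

lemma fill_all:
  assumes "fillable slots \<rho>" "card V \<le> \<rho>"
  obtains vs \<P> where "good vs \<P>" "set vs = V"
proof -
  have "reachable (length slots) \<rho> [] {{}, V}" using assms(2) by (simp add: reachable_def)
  moreover have "slots = [] @ slots @ []" by simp
  ultimately obtain vs \<P> where vs: "advance [] {{}, V} vs \<P>" "set vs = V \<or> length vs = length slots"
    using assms(1) good_init unfolding fillable_def
    by (metis add_0 list.size(3))
  then have "good vs \<P>" by (simp add: advance_def)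
  moreover from this have "distinct vs" "set vs \<subseteq> V" using good_basic by auto
  then have "set vs = V" using vs(2) card_V finite_V by (metis card_seteq distinct_card)
  ultimately show ?thesis using that by blast
qed

end


text \<open>Only the slots with numbers below \<open>n\<close> become vertices, since the sequence
  may be longer than \<open>n\<close>.\<close>

definition reach_graph :: "nat \<Rightarrow> nat option list \<Rightarrow> nat \<Rightarrow> nat graph" where
  "reach_graph R xs n = \<lparr>verts = {..<n},
     edges = {{a, b} |a b. a < b \<and> b < n \<and> slot_time xs b \<le> slot_time xs a + slot_reach R xs a}\<rparr>"

lemma finite_simple_reach_graph: "finite_simple_graph (reach_graph R xs n)"
  unfolding finite_simple_graph_def reach_graph_def by fastforce

lemma treewidth_separable:
  assumes H: "finite_simple_graph H" "treewidth H \<le> w"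
    and A: "A \<subseteq> verts H" "1 \<le> \<alpha>" "\<alpha> \<le> card A"
  shows "\<exists>X cs. X \<subseteq> A \<and> card X \<le> Suc w \<and>
    (\<forall>c\<in>set cs. c \<subseteq> A - X \<and> card c < \<alpha> \<and> card c \<le> card (hd cs)) \<and>
    (\<forall>c\<in>set cs. \<forall>u\<in>c. \<forall>v\<in>A - c - X. {u, v} \<notin> edges H) \<and> \<alpha> \<le> card X + card (\<Union> (set cs))"
proof -
  obtain T :: "nat graph" and B where T: "tree_decomposition H T B"
    and width: "decomposition_width T B = treewidth H"
    using treewidth_attained[OF H(1)] by blast
  obtain ts par where ts: "rooted_decomposition (verts H) (edges H) (length ts) par (\<lambda>i. B (ts ! i))"
    "set ts = verts T"
    using tree_decomposition_rooted[OF T] by blast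
  interpret rooted_decomposition "verts H" "edges H" "length ts" par "\<lambda>i. B (ts ! i)" by (rule ts(1))
  have finV: "finite (verts H)" using H by (simp add: finite_simple_graph_def)
  then have "finite A" using A finite_subset by blast
  from separator[OF this A] obtain i cs where i: "i < length ts"
    and cs: "\<And>c. c \<in> set cs \<Longrightarrow> c \<subseteq> A - B (ts ! i) \<and> card c < \<alpha> \<and> card c \<le> card (hd cs)"
      "\<And>c u v. c \<in> set cs \<Longrightarrow> u \<in> c \<Longrightarrow> v \<in> A - c - B (ts ! i) \<Longrightarrow> {u, v} \<notin> edges H"
    and \<alpha>: "\<alpha> \<le> card (A \<inter> B (ts ! i)) + card (\<Union> (set cs))"
    by metis
  have t: "ts ! i \<in> verts T" using i ts(2) nth_mem by blast
  then have "finite (B (ts ! i))" using T finV finite_subset by (auto simp: tree_decomposition_def)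
  then have "card (A \<inter> B (ts ! i)) \<le> card (B (ts ! i))" by (intro card_mono) auto
  also have "\<dots> \<le> Max ((\<lambda>t. card (B t)) ` verts T)"
    using t T by (intro Max_ge) (auto simp: tree_decomposition_def is_tree_def finite_simple_graph_def)
  also have "\<dots> \<le> Suc w" using width H by (simp add: decomposition_width_def)
  finally have "card (A \<inter> B (ts ! i)) \<le> Suc w" .
  moreover have "A - (A \<inter> B (ts ! i)) = A - B (ts ! i)"
    "A - c - (A \<inter> B (ts ! i)) = A - c - B (ts ! i)" for c by auto
  ultimately show ?thesis using cs \<alpha> by (intro exI[of _ "A \<inter> B (ts ! i)"] exI[of _ cs]) auto
qed

text \<open>The order in which a graph is filled in embeds it: \<open>vs ! a\<close> goes to slot
  \<open>a\<close>, and \<open>good_edge\<close> keeps all edges within reach. The root has reach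
  \<open>n\<close>, enough for the whole graph, and \<open>3 \<le> h\<close> makes it an inner node,
  whose reach is not subject to \<open>R\<close>.\<close>

lemma universal_reach_graph:
  assumes n: "n \<le> node_len (Suc w) l h" and h: "3 \<le> h"
    and R: "\<And>i. i < 6 \<Longrightarrow> 2 * node_len (Suc w) l i \<le> R"
  shows "universal_for (reach_graph R (node_slots (Suc w) l h n) n) (treewidth_graphs w n)"
  unfolding universal_for_def
proof
  fix H assume "H \<in> treewidth_graphs w n"
  then have H: "finite_simple_graph H" "card (verts H) = n" "treewidth H = w"
    by (auto simp: treewidth_graphs_def)
  define xs where "xs = node_slots (Suc w) l h n"
  interpret separable_filling "verts H" "edges H" xs R "Suc w"
  proof unfold_locales
    show "finite (verts H)" using H by (simp add: finite_simple_graph_def)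
    show "card (verts H) \<le> length xs" using H n by (simp add: xs_def)
  qed (use treewidth_separable[OF H(1)] H(3) in auto)
  have "fillable (node_slots (Suc w) l h n) n" by (rule fill_node) (use R h in auto)
  then have "fillable xs n" by (fold xs_def)
  then obtain vs \<P> where vs: "good vs \<P>" "set vs = verts H" using fill_all H by blast
  have dist: "distinct vs" using good_basic[OF vs(1)] by blast
  then have len: "length vs = n" using vs(2) H(2) distinct_card by metis
  have bij: "bij_betw ((!) vs) {..<n} (verts H)" using dist len vs(2) by (intro bij_betw_nth) auto
  define f where "f = inv_into {..<n} ((!) vs)"
  have f: "bij_betw f (verts H) {..<n}" unfolding f_def using bij by (rule bij_betw_inv_into)
  have f_nth: "f (vs ! a) = a" if "a < n" for a
    using bij that unfolding f_def by (intro inv_into_f_f) (auto simp: bij_betw_def)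
  define H' where "H' = \<lparr>verts = {..<n}, edges = (\<lambda>e. f ` e) ` edges H\<rparr>"
  have "f ` e \<in> edges (reach_graph R xs n)" if e: "e \<in> edges H" for e
  proof -
    have "e \<subseteq> verts H" "card e = 2" using e H by (auto simp: finite_simple_graph_def)
    then obtain u v where uv: "e = {u, v}" "u \<noteq> v" "u \<in> set vs" "v \<in> set vs"
      using vs(2) by (auto simp: card_2_iff)
    then obtain a b where ab: "a < n" "b < n" "u = vs ! a" "v = vs ! b"
      using len by (metis in_set_conv_nth)
    have fe: "f ` e = {a, b}" using uv ab f_nth by auto
    have "a \<noteq> b" using uv ab by auto
    then consider "a < b" | "b < a" by linarith
    then show ?thesis
    proof cases
      case 1
      then show ?thesis using good_edge[OF vs(1) 1] e uv ab len fe by (auto simp: reach_graph_def)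
    next
      case 2
      then show ?thesis using good_edge[OF vs(1) 2] e uv ab len fe
        by (auto simp: reach_graph_def insert_commute)
    qed
  qed
  then have sub: "edges H' \<subseteq> edges (reach_graph R xs n)" by (auto simp: H'_def)
  have "verts H' = verts (reach_graph R xs n)" by (simp add: H'_def reach_graph_def)
  then have "subgraph H' (reach_graph R xs n)"
    using sub finite_simple_reach_graph[of R xs n] unfolding subgraph_def finite_simple_graph_def by auto
  moreover have "isomorphic H H'" using f by (auto simp: isomorphic_def H'_def)
  ultimately show "\<exists>H'. subgraph H' (reach_graph R (node_slots (Suc w) l h n) n) \<and> isomorphic H H'"
    unfolding xs_def by blast
qed

section \<open>Counting edges\<close>

lemma slot_time_append_less: "a < length xs \<Longrightarrow> slot_time (xs @ ys) a = slot_time xs a"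
  by (simp add: slot_time_def)

lemma slot_time_append_ge: "slot_time (xs @ ys) (length xs + a) = leaves xs + slot_time ys a"
  by (simp add: slot_time_def)

lemma slot_time_mono: "a \<le> b \<Longrightarrow> slot_time xs a \<le> slot_time xs b"
proof -
  assume "a \<le> b"
  then have "take b xs = take a xs @ take (b - a) (drop a xs)"
    by (metis le_add_diff_inverse take_add)
  then show ?thesis by (simp add: slot_time_def)
qed

definition leaf_slots :: "nat option list \<Rightarrow> nat set" where
  "leaf_slots xs = {a. a < length xs \<and> xs ! a = None}"

definition separator_slots :: "nat option list \<Rightarrow> nat set" where
  "separator_slots xs = {a. a < length xs \<and> xs ! a \<noteq> None}"

lemma finite_slots [simp]: "finite (leaf_slots xs)" "finite (separator_slots xs)"
  by (auto simp: leaf_slots_def separator_slots_def)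

lemma card_leaf_slots: "card (leaf_slots xs) = leaves xs"
  by (simp add: leaf_slots_def leaves_def length_filter_conv_card)

lemma card_separator_slots: "card (separator_slots xs) + leaves xs = length xs"
proof -
  have "card (separator_slots xs) = length (filter (\<lambda>s. s \<noteq> None) xs)"
    by (simp add: separator_slots_def length_filter_conv_card)
  then show ?thesis using sum_length_filter_compl[of "\<lambda>s. s = None" xs] by (simp add: leaves_def)
qed

lemma inj_on_slot_time_leaf: "inj_on (slot_time xs) (leaf_slots xs)"
proof (rule linorder_inj_onI)
  fix a b assume ab: "a < b" "a \<in> leaf_slots xs" "b \<in> leaf_slots xs"
  then have "slot_time xs a < slot_time xs (Suc a)" by (simp add: slot_time_Suc leaf_slots_def)
  also have "\<dots> \<le> slot_time xs b" using ab by (intro slot_time_mono) simp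
  finally show "slot_time xs a \<noteq> slot_time xs b" by simp
qed (auto simp: leaf_slots_def)

lemma card_leaf_window: "card {b \<in> leaf_slots xs. x \<le> slot_time xs b \<and> slot_time xs b \<le> y} \<le> Suc y - x"
proof -
  have "inj_on (slot_time xs) {b \<in> leaf_slots xs. x \<le> slot_time xs b \<and> slot_time xs b \<le> y}"
    by (rule inj_on_subset[OF inj_on_slot_time_leaf]) auto
  then have "card {b \<in> leaf_slots xs. x \<le> slot_time xs b \<and> slot_time xs b \<le> y} \<le> card {x..y}"
    by (rule card_inj_on_le) auto
  then show ?thesis by simp
qed

text \<open>Integer bounds allow to shift a window to the start of a sublist.\<close>

definition separator_count :: "nat option list \<Rightarrow> int \<Rightarrow> int \<Rightarrow> nat" where
  "separator_count xs s t =
     card {b \<in> separator_slots xs. s \<le> int (slot_time xs b) \<and> int (slot_time xs b) \<le> t}"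

lemma separator_count_append:
  "separator_count (xs @ ys) s t =
    separator_count xs s t + separator_count ys (s - int (leaves xs)) (t - int (leaves xs))"
proof -
  let ?A = "{b \<in> separator_slots xs. s \<le> int (slot_time xs b) \<and> int (slot_time xs b) \<le> t}"
  let ?B = "{b \<in> separator_slots ys. s - int (leaves xs) \<le> int (slot_time ys b) \<and>
    int (slot_time ys b) \<le> t - int (leaves xs)}"
  have "{b \<in> separator_slots (xs @ ys). s \<le> int (slot_time (xs @ ys) b) \<and> int (slot_time (xs @ ys) b) \<le> t} =
      ?A \<union> (\<lambda>b. length xs + b) ` ?B" (is "?C = _")
  proof (intro equalityI subsetI)
    fix b assume b: "b \<in> ?C"
    show "b \<in> ?A \<union> (\<lambda>b. length xs + b) ` ?B"
    proof (cases "b < length xs")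
      case True
      with b show ?thesis by (simp add: separator_slots_def nth_append slot_time_append_less)
    next
      case False
      then obtain c where "b = length xs + c" using le_Suc_ex not_less by blast
      with b show ?thesis by (auto simp: separator_slots_def slot_time_append_ge)
    qed
  next
    fix b assume "b \<in> ?A \<union> (\<lambda>b. length xs + b) ` ?B"
    then show "b \<in> ?C"
      by (auto simp: separator_slots_def slot_time_append_less slot_time_append_ge nth_append)
  qed
  moreover have "card (?A \<union> (\<lambda>b. length xs + b) ` ?B) = card ?A + card ((\<lambda>b. length xs + b) ` ?B)"
    by (intro card_Un_disjoint) (auto simp: separator_slots_def)
  moreover have "card ((\<lambda>b. length xs + b) ` ?B) = card ?B" by (intro card_image) (auto simp: inj_on_def)
  ultimately show ?thesis by (simp add: separator_count_def)
qed

lemma separator_count_le: "separator_count xs s t \<le> card (separator_slots xs)"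
  unfolding separator_count_def by (intro card_mono) auto

lemma separator_count_leaves [simp]: "separator_count (replicate k None) s t = 0"
  by (auto simp: separator_count_def separator_slots_def)

lemma separator_count_separators:
  "separator_count (replicate k (Some r)) s t = (if s \<le> 0 \<and> 0 \<le> t then k else 0)"
proof -
  have "slot_time (replicate k (Some r)) b = 0" for b by (simp add: slot_time_def)
  moreover have "separator_slots (replicate k (Some r)) = {..<k}" by (auto simp: separator_slots_def)
  ultimately show ?thesis by (auto simp: separator_count_def simp flip: lessThan_def)
qed

text \<open>The extra term makes the induction close: four children bring \<open>16000 * W\<close>,
  of which \<open>12000 * W\<close> pay for the new separators and \<open>4000 * W\<close> remain.
  So there is at most one separator per 12000 leaves.\<close>

lemma node_len_overhead:
  assumes "1000 * W \<le> l"
  shows "12000 * node_len W l i + 4000 * W \<le> 12001 * leaf_len l i"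
  using assms by (induction W l i rule: node_len.induct) auto

lemma leaf_len_ratio: "6 * leaf_len l (Suc i) \<le> 11 * leaf_len l i"
  by (induction l i rule: leaf_len.induct) auto

lemma leaf_len_ge: "4 * l \<le> leaf_len l i"
  by (induction l i rule: leaf_len.induct) auto

text \<open>The number of integer times from \<open>0\<close> to \<open>k - 1\<close> in the window
  from \<open>s\<close> to \<open>t\<close>.\<close>

definition overlap :: "int \<Rightarrow> int \<Rightarrow> int \<Rightarrow> int" where
  "overlap s t k = max 0 (min (t + 1) k - max s 0)"

text \<open>Counts the ends at which the window may cut a stretch of \<open>k\<close> leaves. A
  window starting at \<open>0\<close> is not cut there, as it contains the stretch from its
  beginning.\<close>

definition ends_inside :: "int \<Rightarrow> int \<Rightarrow> int \<Rightarrow> int" where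
  "ends_inside s t k = (if 0 < s \<and> s < k then 1 else 0) + (if 0 \<le> t \<and> t < k then 1 else 0)"

lemma overlap_add:
  "0 \<le> a \<Longrightarrow> 0 \<le> b \<Longrightarrow> overlap s t (a + b) = overlap s t a + overlap (s - a) (t - a) b"
  by (auto simp: overlap_def max_def min_def)

lemma ends_inside_add:
  "0 \<le> a \<Longrightarrow> 0 \<le> b \<Longrightarrow> ends_inside s t a + ends_inside (s - a) (t - a) b \<le> ends_inside s t (a + b)"
  by (auto simp: ends_inside_def)

text \<open>A node covered by the window is charged to its leaves by
  \<open>node_len_overhead\<close>. If the window cuts a node, the separators at its start are
  charged to an end of the window inside the node. Each end lies in at most one child, so it pays at
  most \<open>W\<close> for each of at most \<open>i\<close> levels.\<close>

lemma separator_count_node: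
  assumes l: "1000 * W \<le> l" "0 < l"
  shows "12000 * int (separator_count (node_slots W l i \<rho>) s t) \<le>
    overlap s t (int (leaf_len l i)) + 12000 * int W * int i * ends_inside s t (int (leaf_len l i))"
proof (induction i arbitrary: \<rho> s t rule: less_induct)
  case (less i)
  have nonneg: "0 \<le> overlap s t k" "0 \<le> ends_inside s t k" for s t k
    by (auto simp: overlap_def ends_inside_def)
  show ?case
  proof (cases "i < 3")
    case True
    then have "node_slots W l i \<rho> = replicate (node_len W l i) None"
      by (auto simp: less_Suc_eq numeral_3_eq_3)
    then show ?thesis using nonneg by simp
  next
    case False
    define j where "j = i - 3"
    have i: "i = Suc (Suc (Suc j))" using False by (simp add: j_def)
    define p q where "p = int (leaf_len l (Suc j))" "q = int (leaf_len l j)"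
    have len: "int (leaf_len l i) = p + (q + (q + p))" by (simp add: i p_q_def)
    have pq: "0 \<le> p" "0 \<le> q" "0 < p" using leaf_len_ge[of l "Suc j"] l by (simp_all add: p_q_def)
    define c where "c = 12000 * int W"
    define o1 o2 o3 where "o1 = p" "o2 = p + q" "o3 = p + q + q"
    note os = this
    have split: "overlap s t (p + (q + (q + p))) = overlap s t p + overlap (s - o1) (t - o1) q
        + overlap (s - o2) (t - o2) q + overlap (s - o3) (t - o3) p"
      using pq overlap_add[of p "q + (q + p)" s t] overlap_add[of q "q + p" "s - o1" "t - o1"]
        overlap_add[of q p "s - o2" "t - o2"]
      by (simp add: os algebra_simps)
    have ends: "ends_inside s t p + ends_inside (s - o1) (t - o1) q
        + ends_inside (s - o2) (t - o2) q + ends_inside (s - o3) (t - o3) p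
        \<le> ends_inside s t (p + (q + (q + p)))" (is "?e \<le> ?E")
      using pq ends_inside_add[of p "q + (q + p)" s t] ends_inside_add[of q "q + p" "s - o1" "t - o1"]
        ends_inside_add[of q p "s - o2" "t - o2"]
      by (simp add: os algebra_simps)
    obtain r0 r1 r2 r3 where slots: "node_slots W l i \<rho> = replicate W (Some \<rho>) @ node_slots W l (Suc j) r0
        @ node_slots W l j r1 @ node_slots W l j r2 @ node_slots W l (Suc j) r3"
      by (simp add: i Let_def)
    \<comment> \<open>Both child levels are at most \<open>j + 2\<close>, which leaves one of the
      \<open>i\<close> units for the separators of the node itself.\<close>
    have IH: "12000 * int (separator_count (node_slots W l k r) s' t') \<le>
        overlap s' t' (int (leaf_len l k)) + c * (int j + 2) * ends_inside s' t' (int (leaf_len l k))"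
      if "k = j \<or> k = Suc j" for k r s' t'
    proof -
      have "c * int k * ends_inside s' t' (int (leaf_len l k)) \<le> c * (int j + 2) * ends_inside s' t' (int (leaf_len l k))"
        using that nonneg by (intro mult_right_mono mult_left_mono) (auto simp: c_def)
      moreover have "k < i" using that i by auto
      ultimately show ?thesis using less[of k r s' t'] by (simp add: c_def)
    qed
    have count: "int (separator_count (node_slots W l i \<rho>) s t) =
        (if s \<le> 0 \<and> 0 \<le> t then int W else 0) + int (separator_count (node_slots W l (Suc j) r0) s t)
        + int (separator_count (node_slots W l j r1) (s - o1) (t - o1))
        + int (separator_count (node_slots W l j r2) (s - o2) (t - o2))
        + int (separator_count (node_slots W l (Suc j) r3) (s - o3) (t - o3))"
      unfolding slots separator_count_append separator_count_separators
      by (simp add: os p_q_def algebra_simps)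
    have "12000 * int (separator_count (node_slots W l i \<rho>) s t) \<le>
        (if s \<le> 0 \<and> 0 \<le> t then c else 0) + overlap s t (p + (q + (q + p))) + c * (int j + 2) * ?e"
      unfolding count split
      using IH[of "Suc j" r0 s t] IH[of j r1 "s - o1" "t - o1"] IH[of j r2 "s - o2" "t - o2"]
        IH[of "Suc j" r3 "s - o3" "t - o3"]
      by (simp add: p_q_def[symmetric] c_def distrib_left)
    also have "c * (int j + 2) * ?e \<le> c * (int j + 2) * ?E"
      using ends by (intro mult_left_mono) (auto simp: c_def)
    finally have le: "12000 * int (separator_count (node_slots W l i \<rho>) s t) \<le>
        (if s \<le> 0 \<and> 0 \<le> t then c else 0) + overlap s t (p + (q + (q + p))) + c * (int j + 2) * ?E"
      by simp
    show ?thesis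
    proof (cases "?E = 0")
      case False
      then have "1 \<le> ?E" using nonneg(2)[of s t "p + (q + (q + p))"] by linarith
      then have "c * 1 \<le> c * ?E" by (intro mult_left_mono) (auto simp: c_def)
      moreover have "0 \<le> c" by (simp add: c_def)
      ultimately have "(if s \<le> 0 \<and> 0 \<le> t then c else 0) \<le> c * ?E" by (auto split: if_splits)
      with le have "12000 * int (separator_count (node_slots W l i \<rho>) s t) \<le>
          overlap s t (p + (q + (q + p))) + (c * (int j + 2) * ?E + c * ?E)" by linarith
      also have "c * (int j + 2) * ?E + c * ?E = c * int i * ?E" by (simp add: i algebra_simps)
      finally show ?thesis unfolding len c_def .
    next
      case True
      show ?thesis
      proof (cases "s \<le> 0 \<and> 0 \<le> t")
        case False
        with le True show ?thesis unfolding len c_def by auto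
      next
        case inside: True
        with True have "p + (q + (q + p)) \<le> t" by (auto simp: ends_inside_def split: if_splits)
        then have ov: "overlap s t (int (leaf_len l i)) = int (leaf_len l i)"
          using inside pq unfolding len by (auto simp: overlap_def)
        have "12000 * separator_count (node_slots W l i \<rho>) s t \<le> leaf_len l i"
          using separator_count_le[of "node_slots W l i \<rho>" s t]
            card_separator_slots[of "node_slots W l i \<rho>"] node_len_overhead[OF l(1), of i] by simp
        then have "12000 * int (separator_count (node_slots W l i \<rho>) s t) \<le> int (leaf_len l i)"
          by linarith
        moreover have "0 \<le> 12000 * int W * int i * ends_inside s t (int (leaf_len l i))" using nonneg by simp
        ultimately show ?thesis unfolding ov by linarith
      qed
    qed
  qed
qed

section \<open>Sum of the reaches\<close>

definition total_reach :: "nat option list \<Rightarrow> nat" where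
  "total_reach xs = sum_list (map (\<lambda>s. case s of None \<Rightarrow> 0 | Some r \<Rightarrow> r) xs)"

lemma total_reach_simps [simp]:
  "total_reach (xs @ ys) = total_reach xs + total_reach ys"
  "total_reach (replicate k None) = 0" "total_reach (replicate k (Some r)) = k * r"
  by (simp_all add: total_reach_def sum_list_replicate)

lemma total_reach_sum: "total_reach xs = (\<Sum>a\<in>separator_slots xs. slot_reach R xs a)"
proof -
  have "total_reach xs = (\<Sum>a<length xs. case xs ! a of None \<Rightarrow> 0 | Some r \<Rightarrow> r)"
    unfolding total_reach_def sum_list_sum_nth by (simp add: lessThan_atLeast0)
  also have "\<dots> = (\<Sum>a\<in>separator_slots xs. slot_reach R xs a)"
    by (rule sum.mono_neutral_cong_right)
      (auto simp: separator_slots_def slot_reach_def split: option.splits)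
  finally show ?thesis .
qed

text \<open>Up to the share of the separators, the reaches of the children add up to
  \<open>7 * p + 9 * q\<close>. Going down two levels to the long children and three to the short
  ones releases \<open>164 / 100 * (4 * p + 6 * q)\<close>, which is larger because
  \<open>6 * p \<le> 11 * q\<close>; the slack absorbs the separators.\<close>

lemma total_reach_node:
  assumes l: "1000 * W \<le> l"
  shows "real (total_reach (node_slots W l i \<rho>)) \<le>
    real W * (real \<rho> + 164 / 100 * real i * real (leaf_len l i))"
proof (induction i arbitrary: \<rho> rule: less_induct)
  case (less i)
  show ?case
  proof (cases "i < 3")
    case True
    then have "node_slots W l i \<rho> = replicate (node_len W l i) None"
      by (auto simp: less_Suc_eq numeral_3_eq_3)
    then show ?thesis by simp
  next
    case False
    define j where "j = i - 3"
    have i: "i = Suc (Suc (Suc j))" using False by (simp add: j_def)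
    define p q P Q Z where "p = leaf_len l (Suc j)" "q = leaf_len l j"
      "P = node_len W l (Suc j)" "Q = node_len W l j" "Z = W + 2 * P + 2 * Q"
    note defs = this
    define r0 r1 r2 r3 where "r0 = Z + W" "r1 = Z + W - p" "r2 = 2 * (W + P + 2 * Q) - (p + q)"
      "r3 = 2 * Z - (p + 2 * q)"
    note rdefs = this
    have slots: "node_slots W l i \<rho> = replicate W (Some \<rho>) @ node_slots W l (Suc j) r0
        @ node_slots W l j r1 @ node_slots W l j r2 @ node_slots W l (Suc j) r3"
      by (simp add: i Let_def defs rdefs)
    have "p \<le> P" "q \<le> Q" by (simp_all add: defs leaf_len_le_node_len)
    then have rsum: "r0 + r1 + r2 + r3 + 3 * p + 3 * q = 8 * W + 10 * P + 12 * Q"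
      by (simp add: rdefs defs(5))
    have "12000 * P + 4000 * W \<le> 12001 * p" "12000 * Q + 4000 * W \<le> 12001 * q" "6 * p \<le> 11 * q" "4 * l \<le> q"
      using node_len_overhead[OF l] by (simp_all add: defs leaf_len_ratio leaf_len_ge)
    with l have "10 * real P \<le> 12001 / 1200 * real p - 10 / 3 * real W"
      "12 * real Q \<le> 12001 / 1000 * real q - 4 * real W"
      "real p \<le> 11 / 6 * real q" "real W \<le> real q / 4000" "0 \<le> real q"
      by (simp_all add: field_simps flip: of_nat_le_iff[where 'a = real])
    moreover have "real r0 + real r1 + real r2 + real r3 + 3 * real p + 3 * real q
        = 8 * real W + 10 * real P + 12 * real Q"
      using rsum by linarith
    ultimately have r: "real r0 + real r1 + real r2 + real r3 \<le> 164 / 100 * (4 * real p + 6 * real q)"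
      by (simp add: field_simps)
    have IH: "real (total_reach (node_slots W l j r)) \<le> real W * (real r + 164 / 100 * real j * real q)"
      "real (total_reach (node_slots W l (Suc j) r)) \<le> real W * (real r + 164 / 100 * (real j + 1) * real p)" for r
      using less[of j r] less[of "Suc j" r] i by (auto simp: defs add.commute)
    have "real (total_reach (node_slots W l i \<rho>)) \<le> real W * real \<rho>
        + real W * (real r0 + 164 / 100 * (real j + 1) * real p) + real W * (real r1 + 164 / 100 * real j * real q)
        + real W * (real r2 + 164 / 100 * real j * real q) + real W * (real r3 + 164 / 100 * (real j + 1) * real p)"
      unfolding slots using IH(2)[of r0] IH(1)[of r1] IH(1)[of r2] IH(2)[of r3] by simp
    also have "\<dots> = real W * (real \<rho> + (real r0 + real r1 + real r2 + real r3)
        + 164 / 100 * (real j * (2 * real p + 2 * real q) + 2 * real p))"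
      by (simp add: algebra_simps)
    also have "\<dots> \<le> real W * (real \<rho> + 164 / 100 * (4 * real p + 6 * real q)
        + 164 / 100 * (real j * (2 * real p + 2 * real q) + 2 * real p))"
      using r by (intro mult_left_mono) auto
    also have "\<dots> = real W * (real \<rho> + 164 / 100 * real i * (2 * real p + 2 * real q))"
      by (simp add: i algebra_simps)
    also have "2 * real p + 2 * real q = real (leaf_len l i)" by (simp add: i defs)
    finally show ?thesis .
  qed
qed

section \<open>The upper bound\<close>

text \<open>Edges are sorted by the kinds of their earlier and later slots. A leaf followed by a
  separator is counted from the separator and all other pairs from the earlier slot. Thus, except
  between two separators, leaves in a window are counted, at most one per unit of time.\<close>

lemma card_edges_reach_graph:
  assumes "n \<le> length xs"
  shows "card (edges (reach_graph R xs n)) \<le>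
    (\<Sum>a\<in>separator_slots xs. Suc (slot_reach R xs a)
       + separator_count xs (int (slot_time xs a)) (int (slot_time xs a + slot_reach R xs a)))
    + length xs * Suc R"
proof -
  let ?t = "slot_time xs" and ?r = "slot_reach R xs" and ?L = "leaf_slots xs" and ?S = "separator_slots xs"
  define SL where "SL = (SIGMA a:?S. {b \<in> ?L. ?t a \<le> ?t b \<and> ?t b \<le> ?t a + ?r a})"
  define SS where "SS = (SIGMA a:?S. {b \<in> ?S. int (?t a) \<le> int (?t b) \<and> int (?t b) \<le> int (?t a + ?r a)})"
  define LL where "LL = (SIGMA a:?L. {b \<in> ?L. ?t a \<le> ?t b \<and> ?t b \<le> ?t a + R})"
  define LS where "LS = (SIGMA b:?S. {a \<in> ?L. ?t b - R \<le> ?t a \<and> ?t a \<le> ?t b})"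
  have Sigma_le: "card (Sigma A F) \<le> (\<Sum>a\<in>A. c a)"
    if "finite A" "\<And>a. a \<in> A \<Longrightarrow> finite (F a) \<and> card (F a) \<le> c a" for A :: "nat set" and F :: "nat \<Rightarrow> nat set" and c
    using that by (subst card_SigmaI) (auto intro: sum_mono)
  have fin: "finite SL" "finite SS" "finite LL" "finite LS" by (simp_all add: SL_def SS_def LL_def LS_def)
  have "edges (reach_graph R xs n) \<subseteq> (\<lambda>(a, b). {a, b}) ` (SL \<union> SS \<union> LL \<union> prod.swap ` LS)"
  proof
    fix e assume "e \<in> edges (reach_graph R xs n)"
    then obtain a b where e: "e = {a, b}" "a < b" "b < n" "?t b \<le> ?t a + ?r a"
      by (auto simp: reach_graph_def)
    have "?t a \<le> ?t b" using e by (intro slot_time_mono) simp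
    moreover have "a \<in> ?L \<or> a \<in> ?S" "b \<in> ?L \<or> b \<in> ?S"
      using e assms by (auto simp: leaf_slots_def separator_slots_def)
    moreover have "?r a = R" if "a \<in> ?L" using that by (simp add: leaf_slots_def slot_reach_def)
    ultimately have "(a, b) \<in> SL \<union> SS \<union> LL \<union> prod.swap ` LS"
      using e by (auto simp: SL_def SS_def LL_def LS_def image_iff)
    with e show "e \<in> (\<lambda>(a, b). {a, b}) ` (SL \<union> SS \<union> LL \<union> prod.swap ` LS)" by force
  qed
  then have "card (edges (reach_graph R xs n)) \<le> card (SL \<union> SS \<union> LL \<union> prod.swap ` LS)"
    using fin by (intro surj_card_le) auto
  also have "\<dots> \<le> card SL + card SS + card LL + card (prod.swap ` LS)"
    by (meson add_le_mono card_Un_le le_refl le_trans)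
  also have "card SL \<le> (\<Sum>a\<in>?S. Suc (?r a))"
    unfolding SL_def by (intro Sigma_le conjI order_trans[OF card_leaf_window]) auto
  also have "card SS = (\<Sum>a\<in>?S. separator_count xs (int (?t a)) (int (?t a + ?r a)))"
    unfolding SS_def by (subst card_SigmaI) (auto simp: separator_count_def)
  also have "card LL \<le> (\<Sum>a\<in>?L. Suc R)"
    unfolding LL_def by (intro Sigma_le conjI order_trans[OF card_leaf_window]) auto
  also have "card (prod.swap ` LS) \<le> (\<Sum>b\<in>?S. Suc R)"
  proof -
    have "card (prod.swap ` LS) \<le> card LS" using fin by (intro card_image_le)
    also have "\<dots> \<le> (\<Sum>b\<in>?S. Suc R)"
      unfolding LS_def by (intro Sigma_le conjI order_trans[OF card_leaf_window]) auto
    finally show ?thesis .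
  qed
  also have "(\<Sum>a\<in>?S. Suc (?r a)) + (\<Sum>a\<in>?S. separator_count xs (int (?t a)) (int (?t a + ?r a)))
      + (\<Sum>a\<in>?L. Suc R) + (\<Sum>b\<in>?S. Suc R)
    = (\<Sum>a\<in>?S. Suc (?r a) + separator_count xs (int (?t a)) (int (?t a + ?r a))) + length xs * Suc R"
  proof -
    have "(\<Sum>a\<in>?L. Suc R) + (\<Sum>b\<in>?S. Suc R) = length xs * Suc R"
      unfolding card_separator_slots[of xs, symmetric] card_leaf_slots[of xs, symmetric]
      by (simp add: algebra_simps)
    then show ?thesis unfolding sum.distrib by (simp only: add.assoc)
  qed
  finally show ?thesis by simp
qed

text \<open>The window of a separator has two ends, so \<open>separator_count_node\<close> allows it
  one separator per 12000 units of time and \<open>2 * W * h\<close> more. The number of separators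
  is at most a 12000th of the number of leaves.\<close>

lemma card_edges_node:
  assumes l: "1000 * W \<le> l" "0 < l" and n: "n \<le> node_len W l h"
  shows "real (card (edges (reach_graph R (node_slots W l h \<rho>) n))) \<le>
    12001 / 12000 * (real W * (real \<rho> + 164 / 100 * real h * real (leaf_len l h)))
    + (2 + 2 * real W * real h) * (real (leaf_len l h) / 12000)
    + 12001 / 12000 * real (leaf_len l h) * (real R + 1)"
proof -
  define xs where "xs = node_slots W l h \<rho>"
  let ?t = "slot_time xs" and ?r = "slot_reach R xs" and ?S = "separator_slots xs"
  have "real (separator_count xs (int (?t a)) (int (?t a + ?r a))) \<le> (real (?r a) + 1) / 12000 + 2 * real W * real h" for a
  proof -
    let ?s = "int (?t a)" and ?e = "int (?t a + ?r a)" and ?k = "int (leaf_len l h)"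
    have "overlap ?s ?e ?k \<le> int (?r a) + 1" by (auto simp: overlap_def)
    moreover have "12000 * int W * int h * ends_inside ?s ?e ?k \<le> 12000 * int W * int h * 2"
      by (intro mult_left_mono) (auto simp: ends_inside_def)
    ultimately have "12000 * int (separator_count xs ?s ?e) \<le> int (?r a) + 1 + 24000 * (int W * int h)"
      using separator_count_node[OF l, of h \<rho> ?s ?e] by (simp add: xs_def)
    then have "12000 * separator_count xs ?s ?e \<le> ?r a + 1 + 24000 * (W * h)"
      by (simp flip: of_nat_le_iff[where 'a = int])
    then have "12000 * real (separator_count xs ?s ?e) \<le> real (?r a) + 1 + 24000 * (real W * real h)"
      by (simp flip: of_nat_le_iff[where 'a = real])
    then show ?thesis by (simp add: field_simps)
  qed
  then have "(\<Sum>a\<in>?S. real (Suc (?r a) + separator_count xs (int (?t a)) (int (?t a + ?r a))))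
      \<le> (\<Sum>a\<in>?S. 12001 / 12000 * real (?r a) + (12001 / 12000 + 2 * real W * real h))"
    by (intro sum_mono) (simp add: field_simps)
  also have "\<dots> = 12001 / 12000 * real (total_reach xs) + (12001 / 12000 + 2 * real W * real h) * real (card ?S)"
    unfolding total_reach_sum[of xs R] sum.distrib of_nat_sum sum_distrib_left sum_constant
    by (simp add: algebra_simps)
  also have "\<dots> \<le> 12001 / 12000 * (real W * (real \<rho> + 164 / 100 * real h * real (leaf_len l h)))
      + (2 + 2 * real W * real h) * (real (leaf_len l h) / 12000)"
  proof (intro add_mono mult_mono)
    show "real (total_reach xs) \<le> real W * (real \<rho> + 164 / 100 * real h * real (leaf_len l h))"
      unfolding xs_def by (rule total_reach_node[OF l(1)])
    have "12000 * card ?S \<le> leaf_len l h"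
      using card_separator_slots[of xs] node_len_overhead[OF l(1), of h] by (simp add: xs_def)
    then show "real (card ?S) \<le> real (leaf_len l h) / 12000" by simp
  qed auto
  finally have 1: "(\<Sum>a\<in>?S. real (Suc (?r a) + separator_count xs (int (?t a)) (int (?t a + ?r a))))
      \<le> 12001 / 12000 * (real W * (real \<rho> + 164 / 100 * real h * real (leaf_len l h)))
      + (2 + 2 * real W * real h) * (real (leaf_len l h) / 12000)" .
  have "12000 * length xs \<le> 12001 * leaf_len l h" using node_len_overhead[OF l(1), of h] by (simp add: xs_def)
  then have "real (length xs) \<le> 12001 / 12000 * real (leaf_len l h)" by simp
  then have 2: "real (length xs) * (real R + 1) \<le> 12001 / 12000 * real (leaf_len l h) * (real R + 1)"
    by (intro mult_right_mono) auto
  have "real (card (edges (reach_graph R xs n))) \<le>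
      real ((\<Sum>a\<in>?S. Suc (?r a) + separator_count xs (int (?t a)) (int (?t a + ?r a))) + length xs * Suc R)"
    unfolding of_nat_le_iff using n by (intro card_edges_reach_graph) (simp add: xs_def)
  also have "\<dots> = (\<Sum>a\<in>?S. real (Suc (?r a) + separator_count xs (int (?t a)) (int (?t a + ?r a))))
      + real (length xs) * (real R + 1)"
    by (simp add: algebra_simps)
  finally show ?thesis using 1 2 unfolding xs_def by linarith
qed

section \<open>Growth of the levels and numerical estimates\<close>

lemma leaf_len_scale: "leaf_len l i = l * leaf_len 1 i"
  by (induction l i rule: leaf_len.induct) (auto simp: algebra_simps)

text \<open>The base lies just below the real root of \<open>x ^ 3 = 2 * x + 2\<close>, so its
  powers satisfy the recurrence as an inequality.\<close>

lemma leaf_len_growth: "(1769 / 1000) ^ i \<le> real (leaf_len 1 i)"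
proof (induction "1::nat" i rule: leaf_len.induct)
  case (4 i)
  have "(1769 / 1000 :: real) ^ Suc (Suc (Suc i)) = (1769 / 1000) ^ 3 * (1769 / 1000) ^ i"
    by (simp add: power3_eq_cube)
  also have "\<dots> \<le> (2 * (1769 / 1000) + 2) * (1769 / 1000) ^ i"
    by (intro mult_right_mono) (auto simp: power3_eq_cube)
  also have "\<dots> = 2 * (1769 / 1000) ^ Suc i + 2 * (1769 / 1000) ^ i" by (simp add: algebra_simps)
  also have "\<dots> \<le> real (leaf_len 1 (Suc (Suc (Suc i))))" using 4 by simp
  finally show ?case .
qed (auto simp: power2_eq_square)

lemma s_tw_le_card_edges:
  "finite_simple_graph G \<Longrightarrow> card (verts G) = n \<Longrightarrow> universal_for G (treewidth_graphs w n) \<Longrightarrow>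
    s_tw w n \<le> card (edges G)" for G :: "nat graph"
  unfolding s_tw_def by (intro Least_le) blast

text \<open>A crude bound for the case that \<open>n\<close> is at most a constant multiple of
  \<open>w\<close>.\<close>

lemma s_tw_le_square: "s_tw w n \<le> n * n"
proof -
  obtain G :: "nat graph" where G: "finite_simple_graph G" "card (verts G) = n" "card (edges G) = s_tw w n"
    using s_tw_attained by blast
  have fin: "finite (verts G)" using G by (simp add: finite_simple_graph_def)
  have "edges G \<subseteq> (\<lambda>(u, v). {u, v}) ` (verts G \<times> verts G)"
    using G(1) by (fastforce simp: finite_simple_graph_def card_2_iff image_iff)
  then have "card (edges G) \<le> card (verts G \<times> verts G)" using fin by (intro surj_card_le) auto
  with G show ?thesis by (simp add: card_cartesian_product)
qed

text \<open>The fraction 79 / 41 lies between \<open>ln 3 / ln (1769 / 1000)\<close> and 19 / 9.852,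
  which reduces the claim to a comparison of \<open>3 ^ 41\<close> and
  \<open>(1769 / 1000) ^ 79\<close>.\<close>

lemma ln_bound: "1642 / 1000 / ln (1769 / 1000) \<le> 19 / (6 * ln (3::real))"
proof -
  have "41 * ln (3::real) = ln (3 ^ 41)" by (subst ln_realpow) simp_all
  also have "\<dots> \<le> ln ((1769 / 1000) ^ 79)" by (subst ln_le_cancel_iff) (simp_all add: power_divide)
  also have "\<dots> = 79 * ln (1769 / 1000 :: real)" by (subst ln_realpow) simp_all
  finally have "41 * ln 3 \<le> 79 * ln (1769 / 1000 :: real)" .
  moreover have pos: "0 < ln (3::real)" "0 < ln (1769 / 1000 :: real)" by simp_all
  ultimately have "1642 / 1000 * (6 * ln 3) \<le> 19 * ln (1769 / 1000 :: real)" by linarith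
  with pos show ?thesis by (simp add: divide_le_eq le_divide_eq mult.commute)
qed

text \<open>A comparison of coefficients of \<open>W * n * h\<close> and \<open>W * n\<close>. For
  the former, 164 / 100 stays below 1642 / 1000 after multiplication by 12001 / 12000 and 1001 /
  1000 and after adding the separators at the ends of windows.\<close>

lemma edge_bound_estimate:
  fixes W n h :: real
  assumes "1 \<le> W" "0 \<le> n" "0 \<le> h"
  shows "12001 / 12000 * (W * (n + 164 / 100 * h * (1001 / 1000 * n)))
    + (2 + 2 * W * h) * (1001 / 1000 * n / 12000)
    + 12001 / 12000 * (1001 / 1000 * n) * (272007 * W) \<le> 1642 / 1000 * (W * n * h) + 1000000 * (n * W)"
    (is "?l \<le> _")
proof -
  define x where "x = W * n"
  define y where "y = W * n * h"
  have nonneg: "n \<le> x" "0 \<le> y" "0 \<le> x"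
    using assms mult_right_mono[of 1 W n] by (simp_all add: x_def y_def)
  have "?l = (12001 / 12000 + 12001 / 12000 * (1001 / 1000) * 272007) * x
      + (12001 / 12000 * (164 / 100) * (1001 / 1000) + 2002 / 12000000) * y + 2002 / 12000000 * n"
    by (simp add: x_def y_def field_simps)
  also have "\<dots> \<le> 999998 * x + 1642 / 1000 * y + 1 * n"
    using nonneg assms by (intro add_mono mult_right_mono) auto
  also have "\<dots> \<le> 1642 / 1000 * y + 1000000 * x" using nonneg by simp
  finally show ?thesis by (simp only: x_def y_def mult.commute)
qed

text \<open>The level \<open>h\<close> and the scale \<open>l\<close> are chosen such that the root
  has more than \<open>n\<close> but at most \<open>1001 / 1000 * n\<close> leaves and
  \<open>l\<close> is between \<open>1000 * W\<close> and \<open>2000 * W\<close>. The lower bound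
  on \<open>l\<close> makes separators rare, the upper one makes \<open>R\<close> linear in
  \<open>W\<close>.\<close>

lemma s_tw_upper_large:
  assumes w: "1 \<le> w" "w < n" and large: "22000 * Suc w \<le> n"
  shows "real (s_tw w n) \<le> 19 / (6 * ln 3) * (real w + 1) * real n * ln (real n / real w)
    + 1000000 * (real n * (real w + 1))"
proof -
  define W where "W = Suc w"
  define \<sigma> where "\<sigma> = leaf_len 1"
  have step: "6 * \<sigma> (Suc i) \<le> 11 * \<sigma> i" for i unfolding \<sigma>_def by (rule leaf_len_ratio)
  have grow: "(1769 / 1000) ^ i \<le> real (\<sigma> i)" for i unfolding \<sigma>_def by (rule leaf_len_growth)
  have "\<exists>h. n < \<sigma> (Suc h) * 1000 * W"
  proof -
    obtain h where "real n < (1769 / 1000) ^ h" using real_arch_pow[of "1769 / 1000" "real n"] by auto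
    then have "real n < real (\<sigma> h)" using grow[of h] by linarith
    then have "n < \<sigma> h" by simp
    then have "n < \<sigma> h * 1000 * W" by (simp add: W_def)
    moreover have "0 < h"
      using \<open>real n < (1769 / 1000) ^ h\<close> w by (cases h) auto
    ultimately show ?thesis by (metis Suc_pred)
  qed
  then obtain h where h: "n < \<sigma> (Suc h) * 1000 * W" and least: "\<And>k. k < h \<Longrightarrow> \<sigma> (Suc k) * 1000 * W \<le> n"
    using exists_least_iff[of "\<lambda>h. n < \<sigma> (Suc h) * 1000 * W"] by (auto simp: not_less)
  have "3 \<le> h"
  proof (rule ccontr)
    assume "\<not> 3 \<le> h"
    \<comment> \<open>The constant in \<open>large\<close> is \<open>1000 * \<sigma> 3\<close>,
      where \<open>\<sigma> 3 = 22\<close>.\<close>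
    then have "\<sigma> (Suc h) \<le> 22"
      by (auto simp: \<sigma>_def less_Suc_eq numeral_3_eq_3 not_le)
    then have "\<sigma> (Suc h) * (1000 * W) \<le> 22 * (1000 * W)" by (rule mult_le_mono1)
    moreover have "n < \<sigma> (Suc h) * (1000 * W)" using h by (simp only: mult.assoc)
    ultimately show False using large by (simp add: W_def)
  qed
  then have hn: "\<sigma> h * 1000 * W \<le> n" using least[of "h - 1"] by simp
  have \<sigma>0: "0 < \<sigma> h" using grow[of h] zero_less_power[of "1769 / 1000 :: real" h] by (metis gr0I less_eq_real_def not_less of_nat_0 zero_less_divide_iff zero_less_numeral)
  \<comment> \<open>The least scale for which \<open>\<sigma> h * l\<close> exceeds
    \<open>n\<close>. The excess is at most \<open>\<sigma> h\<close>, which is at most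
    \<open>n / 1000\<close> by \<open>hn\<close>.\<close>
  define l where "l = n div \<sigma> h + 1"
  have sl: "leaf_len l h = \<sigma> h * l" by (simp add: leaf_len_scale[of l h] \<sigma>_def)
  have "n < \<sigma> h * l" using dividend_less_times_div[OF \<sigma>0, of n] by (simp add: l_def)
  have lub: "\<sigma> h * l \<le> n + \<sigma> h" by (simp add: l_def)
  have "1000 * W \<le> n div \<sigma> h"
    using hn \<sigma>0 by (simp add: less_eq_div_iff_mult_less_eq mult.commute mult.left_commute)
  then have l: "1000 * W \<le> l" "0 < l" by (simp_all add: l_def)
  \<comment> \<open>Consecutive levels differ by a factor of at most two, so the choice of
    \<open>h\<close> bounds \<open>l\<close> from above.\<close>
  have "\<sigma> (Suc h) \<le> 2 * \<sigma> h" using step[of h] by simp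
  then have "\<sigma> (Suc h) * (1000 * W) \<le> 2 * \<sigma> h * (1000 * W)" by (rule mult_le_mono1)
  moreover have "n < \<sigma> (Suc h) * (1000 * W)" using h by (simp only: mult.assoc)
  ultimately have "n < 2 * \<sigma> h * (1000 * W)" by (rule order.strict_trans2[rotated])
  then have "n < \<sigma> h * (2000 * W)" by simp
  then have "n div \<sigma> h < 2000 * W" using \<sigma>0 by (simp add: div_less_iff_less_mult mult.commute)
  then have l2: "l \<le> 2000 * W" by (simp add: l_def)
  define R where "R = 2 * node_len W l 5"
  have nl5: "node_len W l 5 = 3 * W + 68 * l" by (simp add: eval_nat_numeral)
  have R: "2 * node_len W l i \<le> R" if "i < 6" for i
  proof -
    have "i \<in> {0, 1, 2, 3, 4, 5}" using that by auto
    then show ?thesis unfolding R_def nl5 by (auto simp: eval_nat_numeral)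
  qed
  have nlen: "n \<le> node_len W l h"
    using \<open>n < \<sigma> h * l\<close> sl leaf_len_le_node_len[of l h W] by simp
  define G where "G = reach_graph R (node_slots W l h n) n"
  have "universal_for G (treewidth_graphs w n)"
    unfolding G_def W_def
    by (rule universal_reach_graph) (use nlen \<open>3 \<le> h\<close> R in \<open>simp_all add: W_def\<close>)
  then have "s_tw w n \<le> card (edges G)"
    by (intro s_tw_le_card_edges) (simp_all add: G_def finite_simple_reach_graph, simp add: reach_graph_def)
  then have "real (s_tw w n) \<le> real (card (edges G))" by simp
  also have "\<dots> \<le> 12001 / 12000 * (real W * (real n + 164 / 100 * real h * real (leaf_len l h)))
    + (2 + 2 * real W * real h) * (real (leaf_len l h) / 12000)
    + 12001 / 12000 * real (leaf_len l h) * (real R + 1)"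
    unfolding G_def by (rule card_edges_node[OF l nlen])
  also have "\<dots> \<le> 12001 / 12000 * (real W * (real n + 164 / 100 * real h * (1001 / 1000 * real n)))
    + (2 + 2 * real W * real h) * (1001 / 1000 * real n / 12000)
    + 12001 / 12000 * (1001 / 1000 * real n) * (272007 * real W)"
  proof -
    have "1000 * \<sigma> h \<le> n" using hn mult_le_mono2[of 1 W "\<sigma> h * 1000"] by (simp add: W_def)
    then have "1000 * leaf_len l h \<le> 1001 * n" using lub sl by simp
    then have "1000 * real (leaf_len l h) \<le> 1001 * real n" by (simp flip: of_nat_le_iff[where 'a = real])
    then have s: "real (leaf_len l h) \<le> 1001 / 1000 * real n" by simp
    \<comment> \<open>This follows from \<open>R = 6 * W + 136 * l\<close>,
      \<open>l \<le> 2000 * W\<close> and \<open>1 \<le> W\<close>.\<close>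
    have "R + 1 \<le> 272007 * W" using l2 unfolding R_def nl5 by (simp add: W_def)
    then have "real R + 1 \<le> 272007 * real W" by linarith
    with s show ?thesis by (intro add_mono mult_mono mult_left_mono divide_right_mono) auto
  qed
  also have "\<dots> \<le> 1642 / 1000 * (real W * real n * real h) + 1000000 * (real n * real W)"
    by (rule edge_bound_estimate) (simp_all add: W_def)
  also have "\<dots> \<le> 19 / (6 * ln 3) * (real W * real n * ln (real n / real w)) + 1000000 * (real n * real W)"
  proof -
    \<comment> \<open>Since \<open>\<sigma> h\<close> is at most \<open>n / w\<close> and at least
      \<open>(1769 / 1000) ^ h\<close>, the number of levels is logarithmic in
      \<open>n / w\<close>.\<close>
    have "\<sigma> h * w \<le> \<sigma> h * 1000 * W" by (simp add: W_def)
    also note hn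
    finally have "\<sigma> h * w \<le> n" .
    then have "real (\<sigma> h) * real w \<le> real n" by (simp flip: of_nat_mult)
    then have "real (\<sigma> h) \<le> real n / real w" using w by (simp add: field_simps)
    then have "(1769 / 1000) ^ h \<le> real n / real w" using grow[of h] by simp
    then have "ln ((1769 / 1000) ^ h) \<le> ln (real n / real w)" using w by (subst ln_le_cancel_iff) auto
    then have "real h * ln (1769 / 1000) \<le> ln (real n / real w)" by (simp add: ln_realpow)
    then have hle: "real h \<le> ln (real n / real w) / ln (1769 / 1000)" by (simp add: field_simps)
    have "0 \<le> ln (real n / real w)" using w by simp
    then have "1642 / 1000 * real h \<le> 19 / (6 * ln 3) * ln (real n / real w)"
      using hle mult_right_mono[OF ln_bound, of "ln (real n / real w)"] by simp
    then have "real W * real n * (1642 / 1000 * real h) \<le> real W * real n * (19 / (6 * ln 3) * ln (real n / real w))"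
      by (intro mult_left_mono) auto
    then show ?thesis by (simp add: mult_ac)
  qed
  also have "real W = real w + 1" by (simp add: W_def)
  finally show ?thesis by (simp only: mult_ac)
qed

text \<open>In the range left open, \<open>n\<close> is at most \<open>44000 * w\<close> and the
  trivial bound suffices. Otherwise \<open>w + 1 \<le> 2 * w\<close> doubles the constant of the
  error term.\<close>

lemma s_tw_upper:
  assumes w: "1 \<le> w" "w < n"
  shows "real (s_tw w n) \<le> 19 / (6 * ln 3) * (real w + 1) * real n * ln (real n / real w)
    + 2000000 * (real n * real w)"
proof -
  have w2: "real w + 1 \<le> 2 * real w" using w by simp
  show ?thesis
  proof (cases "22000 * Suc w \<le> n")
    case True
    have "1000000 * (real n * (real w + 1)) \<le> 1000000 * (real n * (2 * real w))"
      using w2 by (intro mult_left_mono) auto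
    with s_tw_upper_large[OF w True] show ?thesis by simp
  next
    case False
    then have "n \<le> 44000 * w" using w by simp
    then have "n * n \<le> n * (44000 * w)" by (rule mult_le_mono2)
    then have "s_tw w n \<le> n * (44000 * w)" using s_tw_le_square le_trans by blast
    then have "real (s_tw w n) \<le> real (n * (44000 * w))" by (rule of_nat_mono)
    also have "\<dots> \<le> 2000000 * (real n * real w)" by simp
    finally have "real (s_tw w n) \<le> 2000000 * (real n * real w)" .
    moreover have "0 \<le> 19 / (6 * ln 3) * (real w + 1) * real n * ln (real n / real w)"
      using w by (intro mult_nonneg_nonneg) auto
    ultimately show ?thesis by linarith
  qed
qed

theorem theorem3:
  shows "\<exists>C\<^sub>1 C\<^sub>2 :: real. 0 \<le> C\<^sub>1 \<and> 0 \<le> C\<^sub>2 \<and>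
    (\<forall>w n :: nat. 1 \<le> w \<and> w < n \<longrightarrow>
       real n * real w * ln (real n / real w) - C\<^sub>1 * (real n * real w) \<le> real (s_tw w n) \<and>
       real (s_tw w n) \<le> 19 / (6 * ln 3) * (real w + 1) * real n * ln (real n / real w)
                      + C\<^sub>2 * (real n * real w))"
proof (intro exI conjI allI impI)
  fix w n :: nat
  assume "1 \<le> w \<and> w < n"
  then show "real n * real w * ln (real n / real w) - 2 * (real n * real w) \<le> real (s_tw w n)"
    and "real (s_tw w n) \<le> 19 / (6 * ln 3) * (real w + 1) * real n * ln (real n / real w)
      + 2000000 * (real n * real w)"
    using s_tw_lower s_tw_upper by blast+
qed simp_all

end
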